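(* Let $(X,\rho_X)$ be a symmetric quandle. Then the category $\mathbf{Ab}(\mathbf{SQ}|_{(X,\rho_X)})$ of abelian group objects in the slice category $\mathbf{SQ}|_{(X,\rho_X)}$ of symmetric quandles over $(X,\rho_X)$ and the category $\mathbf{SQMod}_{(X,\rho_X)}$ of modules over the symmetric quandle $(X,\rho_X)$ are equivalent.
   Context: A quandle is a set $X$ with a binary operation $*$ such that every map $x\mapsto x*y$ is a bijection of $X$, $(x*y)*z=(x*z)*(y*z)$ and $x*x=x$ for all $x,y,z\in X$. Write $x*^{-1}y$ for the unique $z$ with $z*y=x$. A symmetric quandle $(X,\rho_X)$ is a quandle $X$ with a map $\rho_X:X\to X$ (a good involution) such that $\rho_X^2=\mathrm{id}_X$, $\rho_X(x*y)=\rho_X(x)*y$ and $x*\rho_X(y)=x*^{-1}y$ for all $x,y\in X$. A homomorphism of symmetric quandles $f:(X,\rho_X)\to(Y,\rho_Y)$ is a map with $f(x*y)=f(x)*f(y)$ and $f(\rho_X(x))=\rho_Y(f(x))$. $\mathbf{SQ}$ is the category of symmetric quandles and their homomorphisms. An $(X,\rho_X)$-module $\mathscr{F}=(A,\phi,\psi,\eta)$ over a symmetric quandle $(X,\rho_X)$ consists of abelian groups $A_x$ ($x\in X$), group isomorphisms $\phi_{x,y}:A_x\to A_{x*y}$, and group homomorphisms $\psi_{x,y}:A_y\to A_{x*y}$ and $\eta_x:A_x\to A_{\rho_X(x)}$ ($x,y\in X$) such that for all $x,y,z\in X$, $a\in A_z$, $b\in A_y$, $c\in A_x$: - $\phi_{x*y,z}\phi_{x,y}=\phi_{x*z,y*z}\phi_{x,z}$;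 - $\phi_{x*y,z}\psi_{x,y}=\psi_{x*z,y*z}\phi_{y,z}$; - $\eta_{\rho_X(x)}\eta_x=\mathrm{id}$; - $\eta_{x*y}\phi_{x,y}=\phi_{\rho_X(x),y}\eta_x$; - $\psi_{\rho_X(x),y}=\eta_{x*y}\psi_{x,y}$; - $\phi_{x*^{-1}y,y}\phi_{x,\rho_X(y)}=\mathrm{id}$; - $\psi_{x*y,z}(a)=\phi_{x*z,y*z}\psi_{x,z}(a)+\psi_{x*z,y*z}\psi_{y,z}(a)$; - $\phi_{x*^{-1}y,y}\psi_{x,\rho_X(y)}(\eta_y(b))=-\psi_{x*\rho_X(y),y}(b)$; - $\phi_{x,x}(c)+\psi_{x,x}(c)=c$. A morphism ($(X,\rho_X)$-map) from $(A,\phi,\psi,\eta)$ to $(A',\phi',\psi',\eta')$ is a family of group homomorphisms $f_x:A_x\to A'_x$ ($x\in X$) with $\phi'_{x,y}f_x=f_{x*y}\phi_{x,y}$, $\psi'_{x,y}f_y=f_{x*y}\psi_{x,y}$ and $\eta'_xf_x=f_{\rho_X(x)}\eta_x$. These form the category $\mathbf{SQMod}_{(X,\rho_X)}$. The slice category $\mathbf{SQ}|_{(X,\rho_X)}$ has as objects the symmetric quandle homomorphisms $(Y,\rho_Y)\to(X,\rho_X)$ and as morphisms the symmetric quandle homomorphisms commuting with the maps to $(X,\rho_X)$. The product of $f:Y\to X$ and $g:Z\to X$ in it is the pullback $Y\times_XZ=\{(y,z): f(y)=g(z)\}$ with componentwise operation and involution; the terminal object is $\mathrm{id}_X$. Abelian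 group objects are taken with respect to these finite products, and morphisms in $\mathbf{Ab}(\mathbf{SQ}|_{(X,\rho_X)})$ are the slice morphisms that commute with the multiplication maps. *)

theory Defs
  imports "HOL-Algebra.Group"
begin

section \<open>Categories and their equivalence\<close>

text \<open>
  A category is given by a class of objects and hom-sets indexed by pairs of objects.  The same
  value may lie in several hom-sets, so composition, identities and the arrow part of a functor
  take the objects involved as arguments: \<open>Comp C a b c g f\<close> is the composite of
  \<open>f : a \<rightarrow> b\<close> and \<open>g : b \<rightarrow> c\<close>.
\<close>

record ('o, 'm) category =
  Obj :: "'o set"
  Hom :: "'o \<Rightarrow> 'o \<Rightarrow> 'm set"
  Id :: "'o \<Rightarrow> 'm"
  Comp :: "'o \<Rightarrow> 'o \<Rightarrow> 'o \<Rightarrow> 'm \<Rightarrow> 'm \<Rightarrow> 'm"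

locale category =
  fixes C :: "('o, 'm) category"
  assumes Id_in_Hom: "a \<in> Obj C \<Longrightarrow> Id C a \<in> Hom C a a"
    and Comp_in_Hom:
      "\<lbrakk>a \<in> Obj C; b \<in> Obj C; c \<in> Obj C; f \<in> Hom C a b; g \<in> Hom C b c\<rbrakk>
        \<Longrightarrow> Comp C a b c g f \<in> Hom C a c"
    and Comp_Id_right:
      "\<lbrakk>a \<in> Obj C; b \<in> Obj C; f \<in> Hom C a b\<rbrakk> \<Longrightarrow> Comp C a a b f (Id C a) = f"
    and Comp_Id_left:
      "\<lbrakk>a \<in> Obj C; b \<in> Obj C; f \<in> Hom C a b\<rbrakk> \<Longrightarrow> Comp C a b b (Id C b) f = f"
    and Comp_assoc:
      "\<lbrakk>a \<in> Obj C; b \<in> Obj C; c \<in> Obj C; d \<in> Obj C;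
        f \<in> Hom C a b; g \<in> Hom C b c; h \<in> Hom C c d\<rbrakk>
        \<Longrightarrow> Comp C a b d (Comp C b c d h g) f = Comp C a c d h (Comp C a b c g f)"

record ('o1, 'm1, 'o2, 'm2) cat_functor =
  fobj :: "'o1 \<Rightarrow> 'o2"
  fmor :: "'o1 \<Rightarrow> 'o1 \<Rightarrow> 'm1 \<Rightarrow> 'm2"

locale cat_functor =
  fixes C :: "('o1, 'm1) category" and D :: "('o2, 'm2) category"
    and F :: "('o1, 'm1, 'o2, 'm2) cat_functor"
  assumes fobj_in_Obj: "a \<in> Obj C \<Longrightarrow> fobj F a \<in> Obj D"
    and fmor_in_Hom:
      "\<lbrakk>a \<in> Obj C; b \<in> Obj C; f \<in> Hom C a b\<rbrakk> \<Longrightarrow> fmor F a b f \<in> Hom D (fobj F a) (fobj F b)"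
    and fmor_Id: "a \<in> Obj C \<Longrightarrow> fmor F a a (Id C a) = Id D (fobj F a)"
    and fmor_Comp:
      "\<lbrakk>a \<in> Obj C; b \<in> Obj C; c \<in> Obj C; f \<in> Hom C a b; g \<in> Hom C b c\<rbrakk>
        \<Longrightarrow> fmor F a c (Comp C a b c g f) =
            Comp D (fobj F a) (fobj F b) (fobj F c) (fmor F b c g) (fmor F a b f)"

definition id_functor :: "('o, 'm, 'o, 'm) cat_functor" where
  "id_functor = \<lparr>fobj = (\<lambda>a. a), fmor = (\<lambda>a b f. f)\<rparr>"

definition comp_functor ::
  "('o2, 'm2, 'o3, 'm3) cat_functor \<Rightarrow> ('o1, 'm1, 'o2, 'm2) cat_functor
    \<Rightarrow> ('o1, 'm1, 'o3, 'm3) cat_functor" where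
  "comp_functor G F =
    \<lparr>fobj = (\<lambda>a. fobj G (fobj F a)),
     fmor = (\<lambda>a b f. fmor G (fobj F a) (fobj F b) (fmor F a b f))\<rparr>"

definition cat_iso :: "('o, 'm) category \<Rightarrow> 'o \<Rightarrow> 'o \<Rightarrow> 'm \<Rightarrow> bool" where
  "cat_iso C a b f \<longleftrightarrow>
    f \<in> Hom C a b \<and>
    (\<exists>g\<in>Hom C b a. Comp C a b a g f = Id C a \<and> Comp C b a b f g = Id C b)"

definition natural_iso ::
  "('o1, 'm1) category \<Rightarrow> ('o2, 'm2) category
    \<Rightarrow> ('o1, 'm1, 'o2, 'm2) cat_functor \<Rightarrow> ('o1, 'm1, 'o2, 'm2) cat_functor
    \<Rightarrow> ('o1 \<Rightarrow> 'm2) \<Rightarrow> bool" where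
  "natural_iso C D F G \<tau> \<longleftrightarrow>
    (\<forall>a\<in>Obj C. cat_iso D (fobj F a) (fobj G a) (\<tau> a)) \<and>
    (\<forall>a\<in>Obj C. \<forall>b\<in>Obj C. \<forall>f\<in>Hom C a b.
      Comp D (fobj F a) (fobj F b) (fobj G b) (\<tau> b) (fmor F a b f) =
      Comp D (fobj F a) (fobj G a) (fobj G b) (fmor G a b f) (\<tau> a))"

definition equivalent_categories ::
  "('o1, 'm1) category \<Rightarrow> ('o2, 'm2) category \<Rightarrow> bool" where
  "equivalent_categories C D \<longleftrightarrow>
    category C \<and> category D \<and>
    (\<exists>F G \<sigma> \<tau>. cat_functor C D F \<and> cat_functor D C G \<and>
      natural_iso C C (comp_functor G F) id_functor \<sigma> \<and>
      natural_iso D D (comp_functor F G) id_functor \<tau>)"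


section \<open>Symmetric quandles\<close>

record 'a sym_quandle = "'a partial_object" +
  qop :: "'a \<Rightarrow> 'a \<Rightarrow> 'a"  (infixl \<open>\<star>\<index>\<close> 70)
  rho :: "'a \<Rightarrow> 'a"  (\<open>\<rho>\<index>\<close>)

definition qinv :: "'a sym_quandle \<Rightarrow> 'a \<Rightarrow> 'a \<Rightarrow> 'a" where
  "qinv X x y = (THE z. z \<in> carrier X \<and> z \<star>\<^bsub>X\<^esub> y = x)"

locale quandle =
  fixes X :: "'a sym_quandle" (structure)
  assumes qop_bij: "y \<in> carrier X \<Longrightarrow> bij_betw (\<lambda>x. x \<star> y) (carrier X) (carrier X)"
    and qop_distrib:
      "\<lbrakk>x \<in> carrier X; y \<in> carrier X; z \<in> carrier X\<rbrakk> \<Longrightarrow> (x \<star> y) \<star> z = (x \<star> z) \<star> (y \<star> z)"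
    and qop_idem: "x \<in> carrier X \<Longrightarrow> x \<star> x = x"

locale sym_quandle = quandle X for X :: "'a sym_quandle" (structure) +
  assumes rho_closed: "x \<in> carrier X \<Longrightarrow> \<rho> x \<in> carrier X"
    and rho_rho: "x \<in> carrier X \<Longrightarrow> \<rho> (\<rho> x) = x"
    and rho_qop: "\<lbrakk>x \<in> carrier X; y \<in> carrier X\<rbrakk> \<Longrightarrow> \<rho> (x \<star> y) = \<rho> x \<star> y"
    and qop_rho: "\<lbrakk>x \<in> carrier X; y \<in> carrier X\<rbrakk> \<Longrightarrow> x \<star> \<rho> y = qinv X x y"

text \<open>
  Maps between carriers are extensional functions (\<open>\<rightarrow>\<^sub>E\<close>), so that equality of functions is
  equality of maps.
\<close>

definition sq_hom :: "'a sym_quandle \<Rightarrow> 'b sym_quandle \<Rightarrow> ('a \<Rightarrow> 'b) set" where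
  "sq_hom X Y =
    {f \<in> carrier X \<rightarrow>\<^sub>E carrier Y.
      (\<forall>x\<in>carrier X. \<forall>y\<in>carrier X. f (x \<star>\<^bsub>X\<^esub> y) = f x \<star>\<^bsub>Y\<^esub> f y) \<and>
      (\<forall>x\<in>carrier X. f (\<rho>\<^bsub>X\<^esub> x) = \<rho>\<^bsub>Y\<^esub> (f x))}"


section \<open>The slice category over a symmetric quandle\<close>

type_synonym ('x, 'a) slice = "'a sym_quandle \<times> ('a \<Rightarrow> 'x)"

abbreviation tot :: "('x, 'a) slice \<Rightarrow> 'a sym_quandle" where "tot \<equiv> fst"
abbreviation proj :: "('x, 'a) slice \<Rightarrow> 'a \<Rightarrow> 'x" where "proj \<equiv> snd"

definition slice_obj :: "'x sym_quandle \<Rightarrow> ('x, 'a) slice set" where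
  "slice_obj X = {Y. sym_quandle (tot Y) \<and> proj Y \<in> sq_hom (tot Y) X}"

definition slice_hom :: "('x, 'a) slice \<Rightarrow> ('x, 'b) slice \<Rightarrow> ('a \<Rightarrow> 'b) set" where
  "slice_hom Y Z =
    {h \<in> sq_hom (tot Y) (tot Z). \<forall>y\<in>carrier (tot Y). proj Z (h y) = proj Y y}"

text \<open>
  The objects of a category must live in a fixed type \<open>'u\<close>, which plays the role of the universe;
  homomorphisms over \<open>X\<close> are nevertheless defined between arbitrary types, so that pullbacks can
  be formed as sets of pairs.  The operations of an object are unconstrained outside its carrier;
  objects differing only there are isomorphic.
\<close>

definition slice_cat :: "'x sym_quandle \<Rightarrow> (('x, 'u) slice, 'u \<Rightarrow> 'u) category" where
  "slice_cat X =
    \<lparr>Obj = slice_obj X,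
     Hom = slice_hom,
     Id = (\<lambda>Y. \<lambda>y\<in>carrier (tot Y). y),
     Comp = (\<lambda>Y Z W g f. compose (carrier (tot Y)) g f)\<rparr>"

definition slice_terminal :: "'x sym_quandle \<Rightarrow> ('x, 'x) slice" where
  "slice_terminal X = (X, \<lambda>x\<in>carrier X. x)"

definition pullback_carrier :: "('x, 'a) slice \<Rightarrow> ('x, 'b) slice \<Rightarrow> ('a \<times> 'b) set" where
  "pullback_carrier Y Z =
    {(y, z). y \<in> carrier (tot Y) \<and> z \<in> carrier (tot Z) \<and> proj Y y = proj Z z}"

definition slice_prod :: "('x, 'a) slice \<Rightarrow> ('x, 'b) slice \<Rightarrow> ('x, 'a \<times> 'b) slice" where
  "slice_prod Y Z =
    (\<lparr>carrier = pullback_carrier Y Z,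
      qop = (\<lambda>(y, z) (y', z'). (y \<star>\<^bsub>tot Y\<^esub> y', z \<star>\<^bsub>tot Z\<^esub> z')),
      rho = (\<lambda>(y, z). (\<rho>\<^bsub>tot Y\<^esub> y, \<rho>\<^bsub>tot Z\<^esub> z))\<rparr>,
     \<lambda>(y, z)\<in>pullback_carrier Y Z. proj Y y)"

lemma (in quandle) qop_closed:
  "\<lbrakk>x \<in> carrier X; y \<in> carrier X\<rbrakk> \<Longrightarrow> x \<star> y \<in> carrier X"
  using bij_betwE[OF qop_bij] by blast

lemma (in quandle) qinv_eq_iff:
  assumes "x \<in> carrier X" "y \<in> carrier X"
  shows "qinv X x y = z \<longleftrightarrow> z \<in> carrier X \<and> z \<star> y = x"
proof -
  have inj: "inj_on (\<lambda>x. x \<star> y) (carrier X)"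
    and img: "(\<lambda>x. x \<star> y) ` carrier X = carrier X"
    using qop_bij[OF assms(2)] by (simp_all add: bij_betw_def)
  have "x \<in> (\<lambda>x. x \<star> y) ` carrier X"
    using img assms(1) by simp
  then obtain w where w: "w \<in> carrier X" "w \<star> y = x"
    by (elim imageE) simp
  have uniq: "v = w" if "v \<in> carrier X" "v \<star> y = x" for v
    using inj_onD[OF inj, of v w] that w by simp
  have "qinv X x y = w"
    unfolding qinv_def by (rule the_equality) (use w uniq in blast)+
  then show ?thesis
    using w uniq by metis
qed

text \<open>
  \<open>slice_terminal X\<close> and \<open>slice_prod Y Z\<close> are the terminal object and the binary product, the
  latter also when its factors and the test object live in different types.
\<close>

lemma slice_terminal_obj:
  assumes "sym_quandle X"
  shows "slice_terminal X \<in> slice_obj X"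
proof -
  interpret sym_quandle X by fact
  show ?thesis
    using assms qop_closed rho_closed by (auto simp: slice_terminal_def slice_obj_def sq_hom_def)
qed

lemma slice_terminal_universal:
  assumes "Y \<in> slice_obj X"
  shows "slice_hom Y (slice_terminal X) = {proj Y}"
proof -
  have p: "proj Y \<in> sq_hom (tot Y) X"
    using assms by (simp add: slice_obj_def)
  have "h = proj Y" if h: "h \<in> slice_hom Y (slice_terminal X)" for h
  proof (rule extensionalityI[of _ "carrier (tot Y)"])
    show "h \<in> extensional (carrier (tot Y))" "proj Y \<in> extensional (carrier (tot Y))"
      using h p by (auto simp: slice_hom_def sq_hom_def PiE_def)
    show "h y = proj Y y" if "y \<in> carrier (tot Y)" for y
    proof -
      have "h y \<in> carrier X" "(\<lambda>x\<in>carrier X. x) (h y) = proj Y y"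
        using h that by (auto simp: slice_hom_def sq_hom_def slice_terminal_def)
      then show ?thesis by simp
    qed
  qed
  moreover have "proj Y \<in> slice_hom Y (slice_terminal X)"
    using p by (auto simp: slice_hom_def slice_terminal_def sq_hom_def)
  ultimately show ?thesis by blast
qed

lemma slice_prod_obj:
  assumes Y: "Y \<in> slice_obj X" and Z: "Z \<in> slice_obj X"
  shows "slice_prod Y Z \<in> slice_obj X"
proof -
  interpret Y: sym_quandle "tot Y" using Y by (simp add: slice_obj_def)
  interpret Z: sym_quandle "tot Z" using Z by (simp add: slice_obj_def)
  have p: "proj Y \<in> sq_hom (tot Y) X" and q: "proj Z \<in> sq_hom (tot Z) X"
    using Y Z by (simp_all add: slice_obj_def)
  let ?P = "tot (slice_prod Y Z)"
  have carr: "carrier ?P = pullback_carrier Y Z"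
    by (simp add: slice_prod_def)
  have op: "qop ?P (y, z) (y', z') = (y \<star>\<^bsub>tot Y\<^esub> y', z \<star>\<^bsub>tot Z\<^esub> z')" for y z y' z'
    by (simp add: slice_prod_def)
  have rh: "rho ?P (y, z) = (\<rho>\<^bsub>tot Y\<^esub> y, \<rho>\<^bsub>tot Z\<^esub> z)" for y z
    by (simp add: slice_prod_def)
  have mem: "(y, z) \<in> carrier ?P \<longleftrightarrow>
      y \<in> carrier (tot Y) \<and> z \<in> carrier (tot Z) \<and> proj Y y = proj Z z" for y z
    by (simp add: carr pullback_carrier_def)
  have px: "proj Y y \<in> carrier X" if "y \<in> carrier (tot Y)" for y
    using p that by (auto simp: sq_hom_def)
  have qx: "proj Z z \<in> carrier X" if "z \<in> carrier (tot Z)" for z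
    using q that by (auto simp: sq_hom_def)
  have pop: "proj Y (y \<star>\<^bsub>tot Y\<^esub> y') = proj Y y \<star>\<^bsub>X\<^esub> proj Y y'"
    if "y \<in> carrier (tot Y)" "y' \<in> carrier (tot Y)" for y y'
    using p that by (auto simp: sq_hom_def)
  have qop: "proj Z (y \<star>\<^bsub>tot Z\<^esub> y') = proj Z y \<star>\<^bsub>X\<^esub> proj Z y'"
    if "y \<in> carrier (tot Z)" "y' \<in> carrier (tot Z)" for y y'
    using q that by (auto simp: sq_hom_def)
  have prh: "proj Y (\<rho>\<^bsub>tot Y\<^esub> y) = \<rho>\<^bsub>X\<^esub> (proj Y y)" if "y \<in> carrier (tot Y)" for y
    using p that by (auto simp: sq_hom_def)
  have qrh: "proj Z (\<rho>\<^bsub>tot Z\<^esub> y) = \<rho>\<^bsub>X\<^esub> (proj Z y)" if "y \<in> carrier (tot Z)" for y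
    using q that by (auto simp: sq_hom_def)
  have closed: "qop ?P u v \<in> carrier ?P" if "u \<in> carrier ?P" "v \<in> carrier ?P" for u v
    using that
    by (cases u; cases v) (auto simp: mem op pop qop Y.qop_closed Z.qop_closed)
  have rclosed: "rho ?P u \<in> carrier ?P" if "u \<in> carrier ?P" for u
    using that by (cases u) (auto simp: mem rh prh qrh Y.rho_closed Z.rho_closed)
  have cancel_Y: "(y \<star>\<^bsub>tot Y\<^esub> \<rho>\<^bsub>tot Y\<^esub> y') \<star>\<^bsub>tot Y\<^esub> y' = y"
    if "y \<in> carrier (tot Y)" "y' \<in> carrier (tot Y)" for y y'
    using that Y.qop_rho Y.qinv_eq_iff by metis
  have cancel_Z: "(y \<star>\<^bsub>tot Z\<^esub> \<rho>\<^bsub>tot Z\<^esub> y') \<star>\<^bsub>tot Z\<^esub> y' = y"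
    if "y \<in> carrier (tot Z)" "y' \<in> carrier (tot Z)" for y y'
    using that Z.qop_rho Z.qinv_eq_iff by metis
  have cancel: "qop ?P (qop ?P u (rho ?P v)) v = u" if "u \<in> carrier ?P" "v \<in> carrier ?P" for u v
    using that by (cases u; cases v) (auto simp: mem op rh cancel_Y cancel_Z)
  have rr: "rho ?P (rho ?P u) = u" if "u \<in> carrier ?P" for u
    using that by (cases u) (auto simp: mem rh Y.rho_rho Z.rho_rho)
  have quandle: "quandle ?P"
  proof
    fix v assume v: "v \<in> carrier ?P"
    show "bij_betw (\<lambda>u. qop ?P u v) (carrier ?P) (carrier ?P)"
    proof (rule bij_betw_byWitness[where f' = "\<lambda>u. qop ?P u (rho ?P v)"])
      show "\<forall>u\<in>carrier ?P. qop ?P (qop ?P u v) (rho ?P v) = u"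
        using cancel[OF _ rclosed[OF v]] rr[OF v] by simp
      show "\<forall>u\<in>carrier ?P. qop ?P (qop ?P u (rho ?P v)) v = u"
        using cancel v by blast
      show "(\<lambda>u. qop ?P u v) ` carrier ?P \<subseteq> carrier ?P"
        using closed[OF _ v] by blast
      show "(\<lambda>u. qop ?P u (rho ?P v)) ` carrier ?P \<subseteq> carrier ?P"
        using closed[OF _ rclosed[OF v]] by blast
    qed
  next
    fix u v w assume "u \<in> carrier ?P" "v \<in> carrier ?P" "w \<in> carrier ?P"
    then show "qop ?P (qop ?P u v) w = qop ?P (qop ?P u w) (qop ?P v w)"
      by (cases u; cases v; cases w) (auto simp: mem op intro: Y.qop_distrib Z.qop_distrib)
  next
    fix u assume "u \<in> carrier ?P"
    then show "qop ?P u u = u"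
      by (cases u) (auto simp: mem op Y.qop_idem Z.qop_idem)
  qed
  then interpret P: quandle ?P .
  have "sym_quandle ?P"
  proof
    fix u v assume u: "u \<in> carrier ?P" and v: "v \<in> carrier ?P"
    show "qop ?P u (rho ?P v) = qinv ?P u v"
      using P.qinv_eq_iff[OF u v] closed[OF u rclosed[OF v]] cancel[OF u v] by metis
    show "rho ?P (qop ?P u v) = qop ?P (rho ?P u) v"
      using u v by (cases u; cases v) (auto simp: mem op rh Y.rho_qop Z.rho_qop)
  qed (auto simp: rclosed rr)
  moreover have "proj (slice_prod Y Z) = (\<lambda>(y, z)\<in>carrier ?P. proj Y y)"
    by (simp add: slice_prod_def)
  then have "proj (slice_prod Y Z) \<in> sq_hom ?P X"
    using closed rclosed
    by (auto simp: sq_hom_def mem op rh px qx pop prh Y.qop_closed Z.qop_closed qop)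
  ultimately show ?thesis by (simp add: slice_obj_def)
qed

lemma slice_prod_universal:
  assumes Y: "Y \<in> slice_obj X" and Z: "Z \<in> slice_obj X"
    and f: "f \<in> slice_hom T Y" and g: "g \<in> slice_hom T Z"
    and T: "T \<in> slice_obj X"
  defines "P \<equiv> slice_prod Y Z"
  shows "restrict fst (carrier (tot P)) \<in> slice_hom P Y"
    and "restrict snd (carrier (tot P)) \<in> slice_hom P Z"
    and "\<exists>!h. h \<in> slice_hom T P \<and>
      compose (carrier (tot T)) (restrict fst (carrier (tot P))) h = f \<and>
      compose (carrier (tot T)) (restrict snd (carrier (tot P))) h = g"
proof -
  interpret P: sym_quandle "tot P"
    using slice_prod_obj[OF Y Z] by (simp add: slice_obj_def P_def)
  have mem: "(y, z) \<in> carrier (tot P) \<longleftrightarrow>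
      y \<in> carrier (tot Y) \<and> z \<in> carrier (tot Z) \<and> proj Y y = proj Z z" for y z
    by (simp add: P_def slice_prod_def pullback_carrier_def)
  have op: "qop (tot P) u v =
      (fst u \<star>\<^bsub>tot Y\<^esub> fst v, snd u \<star>\<^bsub>tot Z\<^esub> snd v)" for u v
    by (simp add: P_def slice_prod_def case_prod_unfold)
  have rh: "rho (tot P) u = (\<rho>\<^bsub>tot Y\<^esub> (fst u), \<rho>\<^bsub>tot Z\<^esub> (snd u))" for u
    by (simp add: P_def slice_prod_def case_prod_unfold)
  have pr: "proj P u = proj Y (fst u)" if "u \<in> carrier (tot P)" for u
    using that by (simp add: P_def slice_prod_def case_prod_unfold)
  have mem': "u \<in> carrier (tot P) \<longleftrightarrow>
      fst u \<in> carrier (tot Y) \<and> snd u \<in> carrier (tot Z) \<and> proj Y (fst u) = proj Z (snd u)" for u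
    using mem[of "fst u" "snd u"] by simp
  show "restrict fst (carrier (tot P)) \<in> slice_hom P Y"
    using P.qop_closed P.rho_closed by (auto simp: slice_hom_def sq_hom_def op rh mem' pr)
  show "restrict snd (carrier (tot P)) \<in> slice_hom P Z"
    using P.qop_closed P.rho_closed by (auto simp: slice_hom_def sq_hom_def op rh mem' pr)
  let ?h = "\<lambda>t\<in>carrier (tot T). (f t, g t)"
  have fT: "f t \<in> carrier (tot Y)" "g t \<in> carrier (tot Z)"
      "proj Y (f t) = proj T t" "proj Z (g t) = proj T t" if "t \<in> carrier (tot T)" for t
    using f g that by (auto simp: slice_hom_def sq_hom_def)
  interpret T: sym_quandle "tot T"
    using T by (simp add: slice_obj_def)
  note closed = T.qop_closed T.rho_closed
  have ext: "f \<in> extensional (carrier (tot T))" "g \<in> extensional (carrier (tot T))"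
    using f g by (auto simp: slice_hom_def sq_hom_def PiE_def)
  show "\<exists>!h. h \<in> slice_hom T P \<and>
      compose (carrier (tot T)) (restrict fst (carrier (tot P))) h = f \<and>
      compose (carrier (tot T)) (restrict snd (carrier (tot P))) h = g"
  proof (intro ex1I)
    show "?h \<in> slice_hom T P \<and>
        compose (carrier (tot T)) (restrict fst (carrier (tot P))) ?h = f \<and>
        compose (carrier (tot T)) (restrict snd (carrier (tot P))) ?h = g"
    proof (intro conjI)
      show "?h \<in> slice_hom T P"
        using f g by (auto simp: slice_hom_def sq_hom_def op rh mem pr fT closed)
      show "compose (carrier (tot T)) (restrict fst (carrier (tot P))) ?h = f"
        using ext(1) by (auto simp: compose_def mem fT fun_eq_iff extensional_def)
      show "compose (carrier (tot T)) (restrict snd (carrier (tot P))) ?h = g"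
        using ext(2) by (auto simp: compose_def mem fT fun_eq_iff extensional_def)
    qed
  next
    fix h assume h: "h \<in> slice_hom T P \<and>
        compose (carrier (tot T)) (restrict fst (carrier (tot P))) h = f \<and>
        compose (carrier (tot T)) (restrict snd (carrier (tot P))) h = g"
    show "h = ?h"
    proof (rule extensionalityI[of _ "carrier (tot T)"])
      show "h \<in> extensional (carrier (tot T))" "?h \<in> extensional (carrier (tot T))"
        using h by (auto simp: slice_hom_def sq_hom_def PiE_def)
      show "h t = ?h t" if t: "t \<in> carrier (tot T)" for t
      proof -
        have "h t \<in> carrier (tot P)" using h t by (auto simp: slice_hom_def sq_hom_def)
        then have "fst (h t) = f t" "snd (h t) = g t"
          using h t by (auto simp: compose_def fun_eq_iff split: if_splits)
        then show ?thesis using t by (simp add: prod_eq_iff)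
      qed
    qed
  qed
qed


section \<open>Abelian group objects in the slice category\<close>

text \<open>
  An abelian group object is an object \<open>Y\<close> of the slice category with morphisms
  \<open>Y \<times>\<^sub>X Y \<rightarrow> Y\<close>, \<open>X \<rightarrow> Y\<close> and \<open>Y \<rightarrow> Y\<close> making the usual diagrams commute; the diagrams are
  written out on the elements of \<open>Y \<times>\<^sub>X Y \<times>\<^sub>X Y\<close>, \<open>Y\<close> and \<open>Y \<times>\<^sub>X Y\<close>.
\<close>

record ('x, 'u) ab_object =
  base :: "('x, 'u) slice"
  add :: "'u \<times> 'u \<Rightarrow> 'u"
  zero :: "'x \<Rightarrow> 'u"
  neg :: "'u \<Rightarrow> 'u"

locale abelian_group_object =
  fixes X :: "'x sym_quandle" and M :: "('x, 'u) ab_object"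
  assumes base_obj: "base M \<in> slice_obj X"
    and add_hom: "add M \<in> slice_hom (slice_prod (base M) (base M)) (base M)"
    and zero_hom: "zero M \<in> slice_hom (slice_terminal X) (base M)"
    and neg_hom: "neg M \<in> slice_hom (base M) (base M)"
    and add_assoc:
      "\<lbrakk>a \<in> carrier (tot (base M)); b \<in> carrier (tot (base M)); c \<in> carrier (tot (base M));
        proj (base M) a = proj (base M) b; proj (base M) b = proj (base M) c\<rbrakk>
        \<Longrightarrow> add M (add M (a, b), c) = add M (a, add M (b, c))"
    and add_zero_left:
      "a \<in> carrier (tot (base M)) \<Longrightarrow> add M (zero M (proj (base M) a), a) = a"
    and add_zero_right:
      "a \<in> carrier (tot (base M)) \<Longrightarrow> add M (a, zero M (proj (base M) a)) = a"
    and add_neg_left: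
      "a \<in> carrier (tot (base M)) \<Longrightarrow> add M (neg M a, a) = zero M (proj (base M) a)"
    and add_neg_right:
      "a \<in> carrier (tot (base M)) \<Longrightarrow> add M (a, neg M a) = zero M (proj (base M) a)"
    and add_comm:
      "\<lbrakk>a \<in> carrier (tot (base M)); b \<in> carrier (tot (base M));
        proj (base M) a = proj (base M) b\<rbrakk>
        \<Longrightarrow> add M (a, b) = add M (b, a)"

definition ab_hom :: "('x, 'u) ab_object \<Rightarrow> ('x, 'u) ab_object \<Rightarrow> ('u \<Rightarrow> 'u) set" where
  "ab_hom M N =
    {h \<in> slice_hom (base M) (base N).
      \<forall>(a, b)\<in>pullback_carrier (base M) (base M). h (add M (a, b)) = add N (h a, h b)}"

definition Ab_cat :: "'x sym_quandle \<Rightarrow> (('x, 'u) ab_object, 'u \<Rightarrow> 'u) category" where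
  "Ab_cat X =
    \<lparr>Obj = {M. abelian_group_object X M},
     Hom = ab_hom,
     Id = (\<lambda>M. Id (slice_cat X) (base M)),
     Comp = (\<lambda>M N P. Comp (slice_cat X) (base M) (base N) (base P))\<rparr>"


section \<open>Modules over a symmetric quandle\<close>

text \<open>
  The abelian groups \<open>A\<^sub>x\<close> are commutative groups of HOL-Algebra, hence written multiplicatively:
  \<open>\<otimes>\<close> and \<open>inv\<close> stand for \<open>+\<close> and \<open>-\<close>.
\<close>

record ('x, 'u) sq_module =
  grp :: "'x \<Rightarrow> 'u monoid"
  phi :: "'x \<Rightarrow> 'x \<Rightarrow> 'u \<Rightarrow> 'u"
  psi :: "'x \<Rightarrow> 'x \<Rightarrow> 'u \<Rightarrow> 'u"
  eta :: "'x \<Rightarrow> 'u \<Rightarrow> 'u"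

locale sq_module = sym_quandle X
  for X :: "'x sym_quandle" (structure) +
  fixes F :: "('x, 'u) sq_module"
  assumes grp_comm_group: "x \<in> carrier X \<Longrightarrow> comm_group (grp F x)"
    and phi_iso:
      "\<lbrakk>x \<in> carrier X; y \<in> carrier X\<rbrakk> \<Longrightarrow> phi F x y \<in> iso (grp F x) (grp F (x \<star> y))"
    and psi_hom:
      "\<lbrakk>x \<in> carrier X; y \<in> carrier X\<rbrakk> \<Longrightarrow> psi F x y \<in> hom (grp F y) (grp F (x \<star> y))"
    and eta_hom: "x \<in> carrier X \<Longrightarrow> eta F x \<in> hom (grp F x) (grp F (\<rho> x))"
    and phi_phi:
      "\<lbrakk>x \<in> carrier X; y \<in> carrier X; z \<in> carrier X; c \<in> carrier (grp F x)\<rbrakk>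
        \<Longrightarrow> phi F (x \<star> y) z (phi F x y c) = phi F (x \<star> z) (y \<star> z) (phi F x z c)"
    and phi_psi:
      "\<lbrakk>x \<in> carrier X; y \<in> carrier X; z \<in> carrier X; b \<in> carrier (grp F y)\<rbrakk>
        \<Longrightarrow> phi F (x \<star> y) z (psi F x y b) = psi F (x \<star> z) (y \<star> z) (phi F y z b)"
    and eta_eta:
      "\<lbrakk>x \<in> carrier X; c \<in> carrier (grp F x)\<rbrakk> \<Longrightarrow> eta F (\<rho> x) (eta F x c) = c"
    and eta_phi:
      "\<lbrakk>x \<in> carrier X; y \<in> carrier X; c \<in> carrier (grp F x)\<rbrakk>
        \<Longrightarrow> eta F (x \<star> y) (phi F x y c) = phi F (\<rho> x) y (eta F x c)"
    and psi_rho: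
      "\<lbrakk>x \<in> carrier X; y \<in> carrier X; b \<in> carrier (grp F y)\<rbrakk>
        \<Longrightarrow> psi F (\<rho> x) y b = eta F (x \<star> y) (psi F x y b)"
    and phi_phi_rho:
      "\<lbrakk>x \<in> carrier X; y \<in> carrier X; c \<in> carrier (grp F x)\<rbrakk>
        \<Longrightarrow> phi F (qinv X x y) y (phi F x (\<rho> y) c) = c"
    and psi_split:
      "\<lbrakk>x \<in> carrier X; y \<in> carrier X; z \<in> carrier X; a \<in> carrier (grp F z)\<rbrakk>
        \<Longrightarrow> psi F (x \<star> y) z a =
            phi F (x \<star> z) (y \<star> z) (psi F x z a)
              \<otimes>\<^bsub>grp F ((x \<star> y) \<star> z)\<^esub> psi F (x \<star> z) (y \<star> z) (psi F y z a)"
    and phi_psi_rho: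
      "\<lbrakk>x \<in> carrier X; y \<in> carrier X; b \<in> carrier (grp F y)\<rbrakk>
        \<Longrightarrow> phi F (qinv X x y) y (psi F x (\<rho> y) (eta F y b)) =
            inv\<^bsub>grp F x\<^esub> (psi F (x \<star> \<rho> y) y b)"
    and phi_psi_diag:
      "\<lbrakk>x \<in> carrier X; c \<in> carrier (grp F x)\<rbrakk>
        \<Longrightarrow> phi F x x c \<otimes>\<^bsub>grp F x\<^esub> psi F x x c = c"

definition sqmod_hom ::
  "'x sym_quandle \<Rightarrow> ('x, 'u) sq_module \<Rightarrow> ('x, 'u) sq_module \<Rightarrow> ('x \<Rightarrow> 'u \<Rightarrow> 'u) set" where
  "sqmod_hom X F F' =
    {f \<in> (\<Pi>\<^sub>E x\<in>carrier X. hom (grp F x) (grp F' x) \<inter> extensional (carrier (grp F x))).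
      (\<forall>x\<in>carrier X. \<forall>y\<in>carrier X. \<forall>a\<in>carrier (grp F x).
        phi F' x y (f x a) = f (x \<star>\<^bsub>X\<^esub> y) (phi F x y a)) \<and>
      (\<forall>x\<in>carrier X. \<forall>y\<in>carrier X. \<forall>b\<in>carrier (grp F y).
        psi F' x y (f y b) = f (x \<star>\<^bsub>X\<^esub> y) (psi F x y b)) \<and>
      (\<forall>x\<in>carrier X. \<forall>a\<in>carrier (grp F x).
        eta F' x (f x a) = f (\<rho>\<^bsub>X\<^esub> x) (eta F x a))}"

definition SQMod_cat :: "'x sym_quandle \<Rightarrow> (('x, 'u) sq_module, 'x \<Rightarrow> 'u \<Rightarrow> 'u) category" where
  "SQMod_cat X =
    \<lparr>Obj = {F. sq_module X F},
     Hom = sqmod_hom X,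
     Id = (\<lambda>F. \<lambda>x\<in>carrier X. \<lambda>a\<in>carrier (grp F x). a),
     Comp = (\<lambda>F F' F'' g f. \<lambda>x\<in>carrier X. compose (carrier (grp F x)) (g x) (f x))\<rparr>"

end

(*
  An abelian group object Y over X is sent to the module of its fibres A_x with
  phi_{x,y}(a) = a * 0_y, psi_{x,y}(b) = 0_x * b and eta = rho. Since addition is a homomorphism,
  a * b = (a + 0_x) * (0_y + b) = phi_{x,y}(a) + psi_{x,y}(b), so the module determines the operation
  of Y: the functor is fully faithful. It is essentially surjective because this formula defines an
  abelian group object on the disjoint union of the groups of any module.
*)

theory Submission
  imports Defs
begin

text \<open>No functor from modules back to group objects is written down: the total object of a
  module is needed only up to isomorphism, so the inverse functor is left to choice. The two notions
  match because the zero section is a homomorphism. Each module axiom is a law of the total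
  symmetric quandle in which at most one variable is not a zero; conversely, both sides of such a
  law are additive in their variables jointly, so these special cases add up to the law itself. The
  obstacle is size. Objects on both sides live in the same type \<open>'u\<close>, and the disjoint
  union of the groups must fit into \<open>'u\<close> as well. If \<open>'u\<close> and a trivial
  quandle have two elements each, then two copies of Z/2 form a module whose total object would need
  four. Taking \<open>'u\<close> infinite with an injection from \<open>carrier X\<close> makes
  pairs of an index and a group element codable in \<open>'u\<close>.\<close>

section \<open>Fully faithful and essentially surjective functors\<close>

text \<open>Choose for each \<open>d\<close> an object \<open>P d\<close> and mutually inverse
  arrows \<open>t d\<close> and \<open>s d\<close> between \<open>F (P d)\<close> and
  \<open>d\<close>. Conjugating with them carries an arrow of \<open>D\<close> to one between
  objects in the image of \<open>F\<close>, where it has a unique preimage; this is the inverse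
  functor, and \<open>t\<close> is natural by construction.\<close>

lemma equivalent_categoriesI:
  assumes "category C" and "category D" and "cat_functor C D F"
    and fully_faithful: "\<And>a b. \<lbrakk>a \<in> Obj C; b \<in> Obj C\<rbrakk>
      \<Longrightarrow> bij_betw (fmor F a b) (Hom C a b) (Hom D (fobj F a) (fobj F b))"
    and ess_surj: "\<And>d. d \<in> Obj D \<Longrightarrow> \<exists>c\<in>Obj C. \<exists>t. cat_iso D (fobj F c) d t"
  shows "equivalent_categories C D"
proof -
  interpret C: category C by fact
  interpret D: category D by fact
  interpret F: cat_functor C D F by fact
  have "\<forall>d\<in>Obj D. \<exists>c t s. c \<in> Obj C \<and> t \<in> Hom D (fobj F c) d \<and> s \<in> Hom D d (fobj F c) \<and>
      Comp D (fobj F c) d (fobj F c) s t = Id D (fobj F c) \<and> Comp D d (fobj F c) d t s = Id D d"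
    using ess_surj unfolding cat_iso_def by blast
  then obtain P t s where P: "\<And>d. d \<in> Obj D \<Longrightarrow> P d \<in> Obj C"
    and t: "\<And>d. d \<in> Obj D \<Longrightarrow> t d \<in> Hom D (fobj F (P d)) d"
    and s: "\<And>d. d \<in> Obj D \<Longrightarrow> s d \<in> Hom D d (fobj F (P d))"
    and st: "\<And>d. d \<in> Obj D \<Longrightarrow>
      Comp D (fobj F (P d)) d (fobj F (P d)) (s d) (t d) = Id D (fobj F (P d))"
    and ts: "\<And>d. d \<in> Obj D \<Longrightarrow> Comp D d (fobj F (P d)) d (t d) (s d) = Id D d"
    by metis
  define pre where "pre a b = inv_into (Hom C a b) (fmor F a b)" for a b
  have pre_Hom: "pre a b g \<in> Hom C a b" and fmor_pre: "fmor F a b (pre a b g) = g"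
    if "a \<in> Obj C" "b \<in> Obj C" "g \<in> Hom D (fobj F a) (fobj F b)" for a b g
    using that fully_faithful[of a b] unfolding pre_def bij_betw_def
    by (simp_all add: inv_into_into f_inv_into_f)
  have faithful: "f = g"
    if "a \<in> Obj C" "b \<in> Obj C" "f \<in> Hom C a b" "g \<in> Hom C a b" "fmor F a b f = fmor F a b g"
    for a b f g
    using that fully_faithful[of a b] unfolding bij_betw_def inj_on_def by blast
  note FP = F.fobj_in_Obj[OF P]
  \<comment> \<open>The arrow \<open>g\<close> conjugated by the chosen isomorphisms:
    \<open>t d\<close>, then \<open>g\<close>, then \<open>s d'\<close>. It is what \<open>F\<close>
    will take the value of the inverse functor at \<open>g\<close> to.\<close>
  define cj where "cj d d' g =
    Comp D (fobj F (P d)) d (fobj F (P d')) (Comp D d d' (fobj F (P d')) (s d') g) (t d)" for d d' g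
  have cj_Hom: "cj d d' g \<in> Hom D (fobj F (P d)) (fobj F (P d'))"
    if "d \<in> Obj D" "d' \<in> Obj D" "g \<in> Hom D d d'" for d d' g
    unfolding cj_def using that by (intro D.Comp_in_Hom FP t s) auto
  \<comment> \<open>The naturality square of \<open>t\<close>, available before the inverse functor
    is defined.\<close>
  have t_cj: "Comp D (fobj F (P d)) (fobj F (P d')) d' (t d') (cj d d' g) =
      Comp D (fobj F (P d)) d d' g (t d)"
    if d: "d \<in> Obj D" and d': "d' \<in> Obj D" and g: "g \<in> Hom D d d'" for d d' g
  proof -
    have sg: "Comp D d d' (fobj F (P d')) (s d') g \<in> Hom D d (fobj F (P d'))"
      using d d' g by (intro D.Comp_in_Hom FP s)
    have "Comp D (fobj F (P d)) (fobj F (P d')) d' (t d') (cj d d' g) =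
        Comp D (fobj F (P d)) d d'
          (Comp D d (fobj F (P d')) d' (t d') (Comp D d d' (fobj F (P d')) (s d') g)) (t d)"
      unfolding cj_def using D.Comp_assoc[OF FP[OF d] d FP[OF d'] d' t[OF d] sg t[OF d']] by simp
    also have "Comp D d (fobj F (P d')) d' (t d') (Comp D d d' (fobj F (P d')) (s d') g) = g"
      using D.Comp_assoc[OF d d' FP[OF d'] d' g s[OF d'] t[OF d']] ts[OF d']
        D.Comp_Id_left[OF d d' g] by simp
    finally show ?thesis .
  qed
  \<comment> \<open>\<open>t d\<close> has the left inverse \<open>s d\<close>, so equations between
    conjugates may be checked after composing with \<open>t\<close>, where \<open>t_cj\<close> makes
    the conjugation disappear.\<close>
  have t_mono: "h = h'"
    if a: "a \<in> Obj D" and d: "d \<in> Obj D"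
      and h: "h \<in> Hom D a (fobj F (P d))" and h': "h' \<in> Hom D a (fobj F (P d))"
      and eq: "Comp D a (fobj F (P d)) d (t d) h = Comp D a (fobj F (P d)) d (t d) h'" for a d h h'
  proof -
    have *: "Comp D a d (fobj F (P d)) (s d) (Comp D a (fobj F (P d)) d (t d) k) = k"
      if "k \<in> Hom D a (fobj F (P d))" for k
      using D.Comp_assoc[OF a FP[OF d] d FP[OF d] that t[OF d] s[OF d]] st[OF d]
        D.Comp_Id_left[OF a FP[OF d] that] by simp
    show ?thesis
      using arg_cong[OF eq, of "Comp D a d (fobj F (P d)) (s d)"] by (simp only: *[OF h] *[OF h'])
  qed
  define G where "G = \<lparr>fobj = P, fmor = \<lambda>d d' g. pre (P d) (P d') (cj d d' g)\<rparr>"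
  have G_simps: "fobj G d = P d" "fmor G d d' g = pre (P d) (P d') (cj d d' g)" for d d' g
    by (simp_all add: G_def)
  have cj_Id: "cj d d (Id D d) = Id D (fobj F (P d))" if d: "d \<in> Obj D" for d
    unfolding cj_def using D.Comp_Id_right[OF d FP[OF d] s[OF d]] st[OF d] by simp
  have cj_Comp: "cj a c (Comp D a b c g f) =
      Comp D (fobj F (P a)) (fobj F (P b)) (fobj F (P c)) (cj b c g) (cj a b f)"
    if a: "a \<in> Obj D" and b: "b \<in> Obj D" and c: "c \<in> Obj D"
      and f: "f \<in> Hom D a b" and g: "g \<in> Hom D b c" for a b c f g
  proof (rule t_mono[OF FP[OF a] c])
    note gf = D.Comp_in_Hom[OF a b c f g]
    show "cj a c (Comp D a b c g f) \<in> Hom D (fobj F (P a)) (fobj F (P c))"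
      using cj_Hom[OF a c gf] .
    show "Comp D (fobj F (P a)) (fobj F (P b)) (fobj F (P c)) (cj b c g) (cj a b f)
        \<in> Hom D (fobj F (P a)) (fobj F (P c))"
      using D.Comp_in_Hom[OF FP[OF a] FP[OF b] FP[OF c] cj_Hom[OF a b f] cj_Hom[OF b c g]] .
    have "Comp D (fobj F (P a)) (fobj F (P c)) c (t c)
        (Comp D (fobj F (P a)) (fobj F (P b)) (fobj F (P c)) (cj b c g) (cj a b f)) =
        Comp D (fobj F (P a)) (fobj F (P b)) c
          (Comp D (fobj F (P b)) b c g (t b)) (cj a b f)"
      using D.Comp_assoc[OF FP[OF a] FP[OF b] FP[OF c] c cj_Hom[OF a b f] cj_Hom[OF b c g] t[OF c]]
        t_cj[OF b c g] by simp
    also have "\<dots> = Comp D (fobj F (P a)) b c g (Comp D (fobj F (P a)) a b f (t a))"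
      using D.Comp_assoc[OF FP[OF a] FP[OF b] b c cj_Hom[OF a b f] t[OF b] g] t_cj[OF a b f] by simp
    also have "\<dots> = Comp D (fobj F (P a)) a c (Comp D a b c g f) (t a)"
      using D.Comp_assoc[OF FP[OF a] a b c t[OF a] f g] by simp
    finally show "Comp D (fobj F (P a)) (fobj F (P c)) c (t c) (cj a c (Comp D a b c g f)) =
        Comp D (fobj F (P a)) (fobj F (P c)) c (t c)
        (Comp D (fobj F (P a)) (fobj F (P b)) (fobj F (P c)) (cj b c g) (cj a b f))"
      using t_cj[OF a c gf] by simp
  qed
  note pcj_Hom = pre_Hom[OF P P cj_Hom] and fmor_pcj = fmor_pre[OF P P cj_Hom]
  have "cat_functor D C G"
  proof
    fix a assume "a \<in> Obj D"
    then show "fobj G a \<in> Obj C" by (simp add: G_simps P)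
  next
    fix a b f assume "a \<in> Obj D" "b \<in> Obj D" "f \<in> Hom D a b"
    then show "fmor G a b f \<in> Hom C (fobj G a) (fobj G b)" by (simp add: G_simps pcj_Hom)
  next
    fix a assume a: "a \<in> Obj D"
    note I = D.Id_in_Hom[OF a]
    show "fmor G a a (Id D a) = Id C (fobj G a)"
      unfolding G_simps
      by (rule faithful[OF P[OF a] P[OF a] pcj_Hom[OF a a a a I] C.Id_in_Hom[OF P[OF a]]])
        (simp add: fmor_pre D.Id_in_Hom FP a cj_Id F.fmor_Id P)
  next
    fix a b c f g
    assume a: "a \<in> Obj D" and b: "b \<in> Obj D" and c: "c \<in> Obj D"
      and f: "f \<in> Hom D a b" and g: "g \<in> Hom D b c"
    note gf = D.Comp_in_Hom[OF a b c f g]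
    show "fmor G a c (Comp D a b c g f) =
        Comp C (fobj G a) (fobj G b) (fobj G c) (fmor G b c g) (fmor G a b f)"
      unfolding G_simps
    proof (rule faithful[OF P[OF a] P[OF c] pcj_Hom[OF a c a c gf]])
      show "Comp C (P a) (P b) (P c) (pre (P b) (P c) (cj b c g)) (pre (P a) (P b) (cj a b f))
          \<in> Hom C (P a) (P c)"
        using a b c f g by (intro C.Comp_in_Hom P pcj_Hom)
    qed (simp add: F.fmor_Comp[OF P[OF a] P[OF b] P[OF c]] pcj_Hom fmor_pcj a b c f g gf
        flip: cj_Comp)
  qed
  \<comment> \<open>The other natural isomorphism is the lift of \<open>t\<close> at objects of the
    form \<open>F a\<close>; its properties hold after applying \<open>F\<close>, hence by
    faithfulness in \<open>C\<close>.\<close>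
  moreover define \<sigma> where "\<sigma> a = pre (P (fobj F a)) a (t (fobj F a))" for a
  note FO = F.fobj_in_Obj
  have \<sigma>_Hom: "\<sigma> a \<in> Hom C (P (fobj F a)) a"
    and fmor_\<sigma>: "fmor F (P (fobj F a)) a (\<sigma> a) = t (fobj F a)" if "a \<in> Obj C" for a
    unfolding \<sigma>_def using that by (simp_all add: pre_Hom fmor_pre P FO t)
  have "natural_iso C C (comp_functor G F) id_functor \<sigma>"
    unfolding natural_iso_def comp_functor_def id_functor_def cat_functor.simps G_simps
  proof (intro conjI ballI)
    fix a assume a: "a \<in> Obj C"
    note Pa = P[OF FO[OF a]]
    \<comment> \<open>The inverse of \<open>\<sigma> a\<close> is the lift of \<open>s\<close> at
      \<open>F a\<close>.\<close>
    define s' where "s' = pre a (P (fobj F a)) (s (fobj F a))"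
    have s': "s' \<in> Hom C a (P (fobj F a))" "fmor F a (P (fobj F a)) s' = s (fobj F a)"
      unfolding s'_def using a by (simp_all add: pre_Hom fmor_pre P FO s)
    have "Comp C (P (fobj F a)) a (P (fobj F a)) s' (\<sigma> a) = Id C (P (fobj F a))"
      by (rule faithful[OF Pa Pa C.Comp_in_Hom[OF Pa a Pa \<sigma>_Hom[OF a] s'(1)] C.Id_in_Hom[OF Pa]])
        (simp add: F.fmor_Comp[OF Pa a Pa \<sigma>_Hom[OF a] s'(1)] s' fmor_\<sigma> a F.fmor_Id Pa st FO)
    moreover have "Comp C a (P (fobj F a)) a (\<sigma> a) s' = Id C a"
      by (rule faithful[OF a a C.Comp_in_Hom[OF a Pa a s'(1) \<sigma>_Hom[OF a]] C.Id_in_Hom[OF a]])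
        (simp add: F.fmor_Comp[OF a Pa a s'(1) \<sigma>_Hom[OF a]] s' fmor_\<sigma> a F.fmor_Id ts FO)
    ultimately show "cat_iso C (P (fobj F a)) a (\<sigma> a)"
      unfolding cat_iso_def using \<sigma>_Hom[OF a] s'(1) by blast
  next
    fix a b f assume a: "a \<in> Obj C" and b: "b \<in> Obj C" and f: "f \<in> Hom C a b"
    note Pa = P[OF FO[OF a]] and Pb = P[OF FO[OF b]] and Ff = F.fmor_in_Hom[OF a b f]
    note GFf = pcj_Hom[OF FO[OF a] FO[OF b] FO[OF a] FO[OF b] Ff]
    show "Comp C (P (fobj F a)) (P (fobj F b)) b (\<sigma> b)
        (pre (P (fobj F a)) (P (fobj F b)) (cj (fobj F a) (fobj F b) (fmor F a b f))) =
        Comp C (P (fobj F a)) a b f (\<sigma> a)"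
      by (rule faithful[OF Pa b C.Comp_in_Hom[OF Pa Pb b GFf \<sigma>_Hom[OF b]]
            C.Comp_in_Hom[OF Pa a b \<sigma>_Hom[OF a] f]])
        (simp add: F.fmor_Comp[OF Pa Pb b GFf \<sigma>_Hom[OF b]] F.fmor_Comp[OF Pa a b \<sigma>_Hom[OF a] f]
          fmor_\<sigma> a b fmor_pcj FO Ff t_cj)
  qed
  moreover have "natural_iso D D (comp_functor F G) id_functor t"
    unfolding natural_iso_def comp_functor_def id_functor_def cat_functor.simps G_simps
  proof (intro conjI ballI)
    fix d assume "d \<in> Obj D"
    then show "cat_iso D (fobj F (P d)) d (t d)"
      unfolding cat_iso_def using s t st ts by blast
  next
    fix d d' g assume "d \<in> Obj D" "d' \<in> Obj D" "g \<in> Hom D d d'"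
    then show "Comp D (fobj F (P d)) (fobj F (P d')) d' (t d')
        (fmor F (P d) (P d') (pre (P d) (P d') (cj d d' g))) =
        Comp D (fobj F (P d)) d d' g (t d)"
      by (simp add: fmor_pcj t_cj)
  qed
  ultimately show ?thesis
    unfolding equivalent_categories_def using assms(1-3) by blast
qed


section \<open>The fibre module of an abelian group object\<close>

lemma sq_homD:
  assumes "f \<in> sq_hom X Y"
  shows "f \<in> extensional (carrier X)"
    and "x \<in> carrier X \<Longrightarrow> f x \<in> carrier Y"
    and "\<lbrakk>x \<in> carrier X; y \<in> carrier X\<rbrakk> \<Longrightarrow> f (x \<star>\<^bsub>X\<^esub> y) = f x \<star>\<^bsub>Y\<^esub> f y"
    and "x \<in> carrier X \<Longrightarrow> f (\<rho>\<^bsub>X\<^esub> x) = \<rho>\<^bsub>Y\<^esub> (f x)"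
  using assms by (auto simp: sq_hom_def PiE_def)

lemma ab_homD:
  assumes "h \<in> ab_hom M N"
  shows "h \<in> extensional (carrier (tot (base M)))"
    and "a \<in> carrier (tot (base M)) \<Longrightarrow> h a \<in> carrier (tot (base N))"
    and "\<lbrakk>a \<in> carrier (tot (base M)); b \<in> carrier (tot (base M))\<rbrakk>
      \<Longrightarrow> h (a \<star>\<^bsub>tot (base M)\<^esub> b) = h a \<star>\<^bsub>tot (base N)\<^esub> h b"
    and "a \<in> carrier (tot (base M)) \<Longrightarrow> h (\<rho>\<^bsub>tot (base M)\<^esub> a) = \<rho>\<^bsub>tot (base N)\<^esub> (h a)"
    and "a \<in> carrier (tot (base M)) \<Longrightarrow> proj (base N) (h a) = proj (base M) a"
    and "\<lbrakk>a \<in> carrier (tot (base M)); b \<in> carrier (tot (base M));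
        proj (base M) a = proj (base M) b\<rbrakk>
      \<Longrightarrow> h (add M (a, b)) = add N (h a, h b)"
  using assms by (auto simp: ab_hom_def slice_hom_def sq_hom_def pullback_carrier_def PiE_def)

lemma ab_homI:
  assumes "h \<in> extensional (carrier (tot (base M)))"
    and "\<And>a. a \<in> carrier (tot (base M)) \<Longrightarrow> h a \<in> carrier (tot (base N))"
    and "\<And>a b. \<lbrakk>a \<in> carrier (tot (base M)); b \<in> carrier (tot (base M))\<rbrakk>
      \<Longrightarrow> h (a \<star>\<^bsub>tot (base M)\<^esub> b) = h a \<star>\<^bsub>tot (base N)\<^esub> h b"
    and "\<And>a. a \<in> carrier (tot (base M))
      \<Longrightarrow> h (\<rho>\<^bsub>tot (base M)\<^esub> a) = \<rho>\<^bsub>tot (base N)\<^esub> (h a)"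
    and "\<And>a. a \<in> carrier (tot (base M)) \<Longrightarrow> proj (base N) (h a) = proj (base M) a"
    and "\<And>a b. \<lbrakk>a \<in> carrier (tot (base M)); b \<in> carrier (tot (base M));
        proj (base M) a = proj (base M) b\<rbrakk>
      \<Longrightarrow> h (add M (a, b)) = add N (h a, h b)"
  shows "h \<in> ab_hom M N"
  using assms by (auto simp: ab_hom_def slice_hom_def sq_hom_def pullback_carrier_def PiE_def)

lemma sqmod_homD:
  assumes "f \<in> sqmod_hom X F F'"
  shows "f \<in> extensional (carrier X)"
    and "x \<in> carrier X \<Longrightarrow> f x \<in> hom (grp F x) (grp F' x)"
    and "x \<in> carrier X \<Longrightarrow> f x \<in> extensional (carrier (grp F x))"
    and "\<lbrakk>x \<in> carrier X; y \<in> carrier X; a \<in> carrier (grp F x)\<rbrakk>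
      \<Longrightarrow> phi F' x y (f x a) = f (x \<star>\<^bsub>X\<^esub> y) (phi F x y a)"
    and "\<lbrakk>x \<in> carrier X; y \<in> carrier X; b \<in> carrier (grp F y)\<rbrakk>
      \<Longrightarrow> psi F' x y (f y b) = f (x \<star>\<^bsub>X\<^esub> y) (psi F x y b)"
    and "\<lbrakk>x \<in> carrier X; a \<in> carrier (grp F x)\<rbrakk>
      \<Longrightarrow> eta F' x (f x a) = f (\<rho>\<^bsub>X\<^esub> x) (eta F x a)"
  using assms by (auto simp: sqmod_hom_def PiE_def Pi_def)

lemma sqmod_homI:
  assumes "f \<in> extensional (carrier X)"
    and "\<And>x. x \<in> carrier X \<Longrightarrow> f x \<in> hom (grp F x) (grp F' x)"
    and "\<And>x. x \<in> carrier X \<Longrightarrow> f x \<in> extensional (carrier (grp F x))"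
    and "\<And>x y a. \<lbrakk>x \<in> carrier X; y \<in> carrier X; a \<in> carrier (grp F x)\<rbrakk>
      \<Longrightarrow> phi F' x y (f x a) = f (x \<star>\<^bsub>X\<^esub> y) (phi F x y a)"
    and "\<And>x y b. \<lbrakk>x \<in> carrier X; y \<in> carrier X; b \<in> carrier (grp F y)\<rbrakk>
      \<Longrightarrow> psi F' x y (f y b) = f (x \<star>\<^bsub>X\<^esub> y) (psi F x y b)"
    and "\<And>x a. \<lbrakk>x \<in> carrier X; a \<in> carrier (grp F x)\<rbrakk>
      \<Longrightarrow> eta F' x (f x a) = f (\<rho>\<^bsub>X\<^esub> x) (eta F x a)"
  shows "f \<in> sqmod_hom X F F'"
  using assms by (auto simp: sqmod_hom_def PiE_def Pi_def)

text \<open>An equational form of \<open>qop_rho\<close> without the definite description in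
  \<open>qinv\<close>. Applied to \<open>\<rho> y\<close> in place of \<open>y\<close> it also gives
  cancellation in the opposite order.\<close>

lemma (in sym_quandle) qop_rho_cancel:
  assumes "x \<in> carrier X" "y \<in> carrier X"
  shows "(x \<star> \<rho> y) \<star> y = x"
  using assms qop_rho qinv_eq_iff by metis

text \<open>One cancellation law replaces both bijectivity and the clause with \<open>qinv\<close>:
  as \<open>\<rho>\<close> is an involution, the law at \<open>\<rho> y\<close> says that right
  multiplications by \<open>y\<close> and by \<open>\<rho> y\<close> are inverse on both
  sides.\<close>

lemma sym_quandleI:
  assumes qop_closed: "\<And>x y. \<lbrakk>x \<in> carrier X; y \<in> carrier X\<rbrakk> \<Longrightarrow> x \<star>\<^bsub>X\<^esub> y \<in> carrier X"
    and rho_closed: "\<And>x. x \<in> carrier X \<Longrightarrow> \<rho>\<^bsub>X\<^esub> x \<in> carrier X"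
    and qop_distrib: "\<And>x y z. \<lbrakk>x \<in> carrier X; y \<in> carrier X; z \<in> carrier X\<rbrakk>
      \<Longrightarrow> (x \<star>\<^bsub>X\<^esub> y) \<star>\<^bsub>X\<^esub> z = (x \<star>\<^bsub>X\<^esub> z) \<star>\<^bsub>X\<^esub> (y \<star>\<^bsub>X\<^esub> z)"
    and qop_idem: "\<And>x. x \<in> carrier X \<Longrightarrow> x \<star>\<^bsub>X\<^esub> x = x"
    and rho_rho: "\<And>x. x \<in> carrier X \<Longrightarrow> \<rho>\<^bsub>X\<^esub> (\<rho>\<^bsub>X\<^esub> x) = x"
    and rho_qop: "\<And>x y. \<lbrakk>x \<in> carrier X; y \<in> carrier X\<rbrakk> \<Longrightarrow> \<rho>\<^bsub>X\<^esub> (x \<star>\<^bsub>X\<^esub> y) = \<rho>\<^bsub>X\<^esub> x \<star>\<^bsub>X\<^esub> y"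
    and cancel: "\<And>x y. \<lbrakk>x \<in> carrier X; y \<in> carrier X\<rbrakk> \<Longrightarrow> (x \<star>\<^bsub>X\<^esub> \<rho>\<^bsub>X\<^esub> y) \<star>\<^bsub>X\<^esub> y = x"
  shows "sym_quandle X"
proof -
  have "quandle X"
  proof
    fix y assume y: "y \<in> carrier X"
    show "bij_betw (\<lambda>x. x \<star>\<^bsub>X\<^esub> y) (carrier X) (carrier X)"
    proof (rule bij_betw_byWitness[where f' = "\<lambda>x. x \<star>\<^bsub>X\<^esub> \<rho>\<^bsub>X\<^esub> y"])
      show "\<forall>x\<in>carrier X. (x \<star>\<^bsub>X\<^esub> y) \<star>\<^bsub>X\<^esub> \<rho>\<^bsub>X\<^esub> y = x"
        using cancel[OF _ rho_closed[OF y]] rho_rho[OF y] by simp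
    qed (use y cancel qop_closed rho_closed in auto)
  qed (use qop_distrib qop_idem in auto)
  then interpret quandle X .
  show ?thesis
  proof
    fix x y assume "x \<in> carrier X" "y \<in> carrier X"
    then show "x \<star>\<^bsub>X\<^esub> \<rho>\<^bsub>X\<^esub> y = qinv X x y"
      using qinv_eq_iff[of x y] qop_closed rho_closed cancel by metis
  qed (use rho_closed rho_rho rho_qop in auto)
qed

section \<open>Elementwise consequences of the axioms of an abelian group object\<close>

context abelian_group_object
begin

abbreviation "Y \<equiv> tot (base M)"
abbreviation "p \<equiv> proj (base M)"

sublocale Y: sym_quandle "tot (base M)"
  using base_obj by (simp add: slice_obj_def)

lemma p_sq_hom: "p \<in> sq_hom Y X"
  using base_obj by (simp add: slice_obj_def)

lemmas p_closed = sq_homD(2)[OF p_sq_hom]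
  and p_qop = sq_homD(3)[OF p_sq_hom]
  and p_rho = sq_homD(4)[OF p_sq_hom]

lemma
  assumes "a \<in> carrier Y" "b \<in> carrier Y" "p a = p b"
  shows add_closed: "add M (a, b) \<in> carrier Y"
    and p_add: "p (add M (a, b)) = p b"
    and rho_add: "\<rho>\<^bsub>Y\<^esub> (add M (a, b)) = add M (\<rho>\<^bsub>Y\<^esub> a, \<rho>\<^bsub>Y\<^esub> b)"
  using add_hom assms
  by (auto simp: slice_hom_def sq_hom_def slice_prod_def pullback_carrier_def PiE_def Pi_def)

text \<open>The interchange law between addition and the quandle operation, which is the
  homomorphism property of addition on the pullback.\<close>

lemma qop_add:
  assumes "a \<in> carrier Y" "b \<in> carrier Y" "p a = p b"
    and "a' \<in> carrier Y" "b' \<in> carrier Y" "p a' = p b'"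
  shows "add M (a, b) \<star>\<^bsub>Y\<^esub> add M (a', b') = add M (a \<star>\<^bsub>Y\<^esub> a', b \<star>\<^bsub>Y\<^esub> b')"
proof -
  have "(a, b) \<in> pullback_carrier (base M) (base M)" "(a', b') \<in> pullback_carrier (base M) (base M)"
    using assms by (simp_all add: pullback_carrier_def)
  then show ?thesis
    using add_hom by (fastforce simp: slice_hom_def sq_hom_def slice_prod_def)
qed

lemma
  assumes "x \<in> carrier X"
  shows zero_closed: "zero M x \<in> carrier Y"
    and p_zero: "p (zero M x) = x"
    and rho_zero: "\<rho>\<^bsub>Y\<^esub> (zero M x) = zero M (\<rho>\<^bsub>X\<^esub> x)"
  using zero_hom assms by (auto simp: slice_hom_def sq_hom_def slice_terminal_def PiE_def Pi_def)

lemma qop_zero: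
  "\<lbrakk>x \<in> carrier X; y \<in> carrier X\<rbrakk> \<Longrightarrow> zero M x \<star>\<^bsub>Y\<^esub> zero M y = zero M (x \<star>\<^bsub>X\<^esub> y)"
  using zero_hom by (auto simp: slice_hom_def sq_hom_def slice_terminal_def)

lemma
  assumes "a \<in> carrier Y"
  shows neg_closed: "neg M a \<in> carrier Y"
    and p_neg: "p (neg M a) = p a"
  using neg_hom assms by (auto simp: slice_hom_def sq_hom_def PiE_def Pi_def)

text \<open>The source of every module axiom that contains a sum or an inverse: such an axiom is a
  quandle identity whose outermost product is split in this way.\<close>

lemma qop_split:
  assumes a: "a \<in> carrier Y" and b: "b \<in> carrier Y"
  shows "a \<star>\<^bsub>Y\<^esub> b = add M (a \<star>\<^bsub>Y\<^esub> zero M (p b), zero M (p a) \<star>\<^bsub>Y\<^esub> b)"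
  using qop_add[of a "zero M (p a)" "zero M (p b)" b] assms
  by (simp add: p_closed zero_closed p_zero add_zero_left add_zero_right)

end

definition fiber_grp :: "('x, 'u) ab_object \<Rightarrow> 'x \<Rightarrow> 'u monoid" where
  "fiber_grp M x =
    \<lparr>carrier = {a \<in> carrier (tot (base M)). proj (base M) a = x},
     mult = (\<lambda>a b. add M (a, b)),
     one = zero M x\<rparr>"

definition fiber_module :: "('x, 'u) ab_object \<Rightarrow> ('x, 'u) sq_module" where
  "fiber_module M =
    \<lparr>grp = fiber_grp M,
     phi = (\<lambda>x y a. a \<star>\<^bsub>tot (base M)\<^esub> zero M y),
     psi = (\<lambda>x y b. zero M x \<star>\<^bsub>tot (base M)\<^esub> b),
     eta = (\<lambda>x a. \<rho>\<^bsub>tot (base M)\<^esub> a)\<rparr>"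

lemma fiber_grp_simps [simp]:
  "a \<in> carrier (fiber_grp M x) \<longleftrightarrow> a \<in> carrier (tot (base M)) \<and> proj (base M) a = x"
  "a \<otimes>\<^bsub>fiber_grp M x\<^esub> b = add M (a, b)"
  "\<one>\<^bsub>fiber_grp M x\<^esub> = zero M x"
  by (simp_all add: fiber_grp_def)

lemma fiber_module_simps [simp]:
  "grp (fiber_module M) = fiber_grp M"
  "phi (fiber_module M) x y a = a \<star>\<^bsub>tot (base M)\<^esub> zero M y"
  "psi (fiber_module M) x y b = zero M x \<star>\<^bsub>tot (base M)\<^esub> b"
  "eta (fiber_module M) x a = \<rho>\<^bsub>tot (base M)\<^esub> a"
  by (simp_all add: fiber_module_def)

context abelian_group_object
begin

lemma comm_group_fiber:
  assumes x: "x \<in> carrier X"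
  shows "comm_group (fiber_grp M x)"
proof (rule comm_groupI)
  fix a assume a: "a \<in> carrier (fiber_grp M x)"
  then show "\<one>\<^bsub>fiber_grp M x\<^esub> \<otimes>\<^bsub>fiber_grp M x\<^esub> a = a"
    using add_zero_left by auto
  show "\<exists>b\<in>carrier (fiber_grp M x). b \<otimes>\<^bsub>fiber_grp M x\<^esub> a = \<one>\<^bsub>fiber_grp M x\<^esub>"
    using a neg_closed p_neg add_neg_left by (intro bexI[of _ "neg M a"]) auto
next
  fix a b c
  assume "a \<in> carrier (fiber_grp M x)" "b \<in> carrier (fiber_grp M x)" "c \<in> carrier (fiber_grp M x)"
  then show "a \<otimes>\<^bsub>fiber_grp M x\<^esub> b \<otimes>\<^bsub>fiber_grp M x\<^esub> c =
      a \<otimes>\<^bsub>fiber_grp M x\<^esub> (b \<otimes>\<^bsub>fiber_grp M x\<^esub> c)"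
    using add_assoc by simp
qed (use x in \<open>auto simp: zero_closed p_zero add_closed p_add add_comm\<close>)

lemma inv_fiber_eqI:
  assumes "a \<in> carrier Y" "b \<in> carrier Y" "p a = x" "p b = x" "add M (a, b) = zero M x"
  shows "a = inv\<^bsub>fiber_grp M x\<^esub> b"
proof -
  interpret comm_group "fiber_grp M x"
    using assms p_closed by (intro comm_group_fiber) auto
  show ?thesis
    using inv_equality[of a b] assms by simp
qed

text \<open>Distributivity at \<open>(c, 0, 0)\<close>, \<open>(0, b, 0)\<close> and
  \<open>(0, 0, a)\<close> gives \<open>phi_phi\<close>, \<open>phi_psi\<close> and
  \<open>psi_split\<close>; the cancellation law at \<open>(c, 0)\<close> and \<open>(0, b)\<close>
  gives \<open>phi_phi_rho\<close> and \<open>phi_psi_rho\<close>; \<open>rho_qop\<close> at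
  \<open>(c, 0)\<close> and \<open>(0, b)\<close> gives \<open>eta_phi\<close> and
  \<open>psi_rho\<close>; idempotence gives \<open>phi_psi_diag\<close>.\<close>

lemma sq_module_fiber_module:
  assumes "sym_quandle X"
  shows "sq_module X (fiber_module M)"
proof -
  interpret X: sym_quandle X by fact
  note closed = X.qop_closed X.rho_closed Y.qop_closed Y.rho_closed p_closed zero_closed add_closed
  show ?thesis
  proof (rule sq_module.intro[OF assms sq_module_axioms.intro])
    fix x assume "x \<in> carrier X"
    then show "comm_group (grp (fiber_module M) x)"
      using comm_group_fiber by simp
  next
    fix x y assume x: "x \<in> carrier X" and y: "y \<in> carrier X"
    note zy = zero_closed[OF y]
    have "phi (fiber_module M) x y \<in> hom (fiber_grp M x) (fiber_grp M (x \<star>\<^bsub>X\<^esub> y))"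
    proof (rule homI)
      \<comment> \<open>Additivity of \<open>phi\<close> is interchange once the zero over
        \<open>y\<close> is written as the sum of two copies of itself.\<close>
      fix a b assume "a \<in> carrier (fiber_grp M x)" "b \<in> carrier (fiber_grp M x)"
      then show "phi (fiber_module M) x y (a \<otimes>\<^bsub>fiber_grp M x\<^esub> b) =
          phi (fiber_module M) x y a \<otimes>\<^bsub>fiber_grp M (x \<star>\<^bsub>X\<^esub> y)\<^esub> phi (fiber_module M) x y b"
        using qop_add[of a b "zero M y" "zero M y"] add_zero_left[OF zy] zy y by (simp add: p_zero)
    qed (use y in \<open>auto simp: closed p_qop p_zero\<close>)
    moreover have "bij_betw (phi (fiber_module M) x y)
        (carrier (fiber_grp M x)) (carrier (fiber_grp M (x \<star>\<^bsub>X\<^esub> y)))"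
    \<comment> \<open>The inverse multiplies by the zero over \<open>\<rho> y\<close>, which is the
      \<open>\<rho>\<close>-image of the zero over \<open>y\<close> because the zero section
      respects the involutions.\<close>
    proof (rule bij_betw_byWitness[where f' = "\<lambda>d. d \<star>\<^bsub>Y\<^esub> zero M (\<rho>\<^bsub>X\<^esub> y)"])
      have 1: "(d \<star>\<^bsub>Y\<^esub> zero M (\<rho>\<^bsub>X\<^esub> y)) \<star>\<^bsub>Y\<^esub> zero M y = d" if "d \<in> carrier Y" for d
        using Y.qop_rho_cancel[OF that zy] rho_zero[OF y] by simp
      have 2: "(d \<star>\<^bsub>Y\<^esub> zero M y) \<star>\<^bsub>Y\<^esub> zero M (\<rho>\<^bsub>X\<^esub> y) = d" if "d \<in> carrier Y" for d
        using Y.qop_rho_cancel[OF that Y.rho_closed[OF zy]] rho_zero[OF y] Y.rho_rho[OF zy] by simp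
      have 3: "(x \<star>\<^bsub>X\<^esub> y) \<star>\<^bsub>X\<^esub> \<rho>\<^bsub>X\<^esub> y = x"
        using X.qop_rho_cancel[OF x X.rho_closed[OF y]] X.rho_rho[OF y] by simp
      show "\<forall>a\<in>carrier (fiber_grp M x). phi (fiber_module M) x y a \<star>\<^bsub>Y\<^esub> zero M (\<rho>\<^bsub>X\<^esub> y) = a"
        using 2 by simp
      show "\<forall>d\<in>carrier (fiber_grp M (x \<star>\<^bsub>X\<^esub> y)).
          phi (fiber_module M) x y (d \<star>\<^bsub>Y\<^esub> zero M (\<rho>\<^bsub>X\<^esub> y)) = d"
        using 1 by simp
      show "phi (fiber_module M) x y ` carrier (fiber_grp M x) \<subseteq> carrier (fiber_grp M (x \<star>\<^bsub>X\<^esub> y))"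
        using y by (auto simp: closed p_qop p_zero)
      show "(\<lambda>d. d \<star>\<^bsub>Y\<^esub> zero M (\<rho>\<^bsub>X\<^esub> y)) ` carrier (fiber_grp M (x \<star>\<^bsub>X\<^esub> y))
          \<subseteq> carrier (fiber_grp M x)"
        using y by (auto simp: closed p_qop p_zero 3)
    qed
    ultimately show "phi (fiber_module M) x y
        \<in> iso (grp (fiber_module M) x) (grp (fiber_module M) (x \<star>\<^bsub>X\<^esub> y))"
      by (simp add: iso_def)
  next
    fix x y assume x: "x \<in> carrier X" and y: "y \<in> carrier X"
    have "psi (fiber_module M) x y \<in> hom (fiber_grp M y) (fiber_grp M (x \<star>\<^bsub>X\<^esub> y))"
    proof (rule homI)
      fix a b assume "a \<in> carrier (fiber_grp M y)" "b \<in> carrier (fiber_grp M y)"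
      then show "psi (fiber_module M) x y (a \<otimes>\<^bsub>fiber_grp M y\<^esub> b) =
          psi (fiber_module M) x y a \<otimes>\<^bsub>fiber_grp M (x \<star>\<^bsub>X\<^esub> y)\<^esub> psi (fiber_module M) x y b"
        using qop_add[of "zero M x" "zero M x" a b] add_zero_left[OF zero_closed[OF x]] x
        by (simp add: p_zero zero_closed)
    qed (use x in \<open>auto simp: closed p_qop p_zero\<close>)
    then show "psi (fiber_module M) x y
        \<in> hom (grp (fiber_module M) y) (grp (fiber_module M) (x \<star>\<^bsub>X\<^esub> y))" by simp
  next
    fix x assume "x \<in> carrier X"
    have "eta (fiber_module M) x \<in> hom (fiber_grp M x) (fiber_grp M (\<rho>\<^bsub>X\<^esub> x))"
      by (rule homI) (auto simp: closed p_rho rho_add)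
    then show "eta (fiber_module M) x
        \<in> hom (grp (fiber_module M) x) (grp (fiber_module M) (\<rho>\<^bsub>X\<^esub> x))" by simp
  next
    fix x y z c
    assume "x \<in> carrier X" "y \<in> carrier X" "z \<in> carrier X" "c \<in> carrier (grp (fiber_module M) x)"
    then show "phi (fiber_module M) (x \<star>\<^bsub>X\<^esub> y) z (phi (fiber_module M) x y c) =
        phi (fiber_module M) (x \<star>\<^bsub>X\<^esub> z) (y \<star>\<^bsub>X\<^esub> z) (phi (fiber_module M) x z c)"
      using Y.qop_distrib[of c "zero M y" "zero M z"] by (simp add: closed qop_zero)
  next
    fix x y z b
    assume "x \<in> carrier X" "y \<in> carrier X" "z \<in> carrier X" "b \<in> carrier (grp (fiber_module M) y)"
    then show "phi (fiber_module M) (x \<star>\<^bsub>X\<^esub> y) z (psi (fiber_module M) x y b) =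
        psi (fiber_module M) (x \<star>\<^bsub>X\<^esub> z) (y \<star>\<^bsub>X\<^esub> z) (phi (fiber_module M) y z b)"
      using Y.qop_distrib[of "zero M x" b "zero M z"] by (simp add: closed qop_zero)
  next
    fix x c assume "x \<in> carrier X" "c \<in> carrier (grp (fiber_module M) x)"
    then show "eta (fiber_module M) (\<rho>\<^bsub>X\<^esub> x) (eta (fiber_module M) x c) = c"
      by (simp add: Y.rho_rho)
  next
    fix x y c assume "x \<in> carrier X" "y \<in> carrier X" "c \<in> carrier (grp (fiber_module M) x)"
    then show "eta (fiber_module M) (x \<star>\<^bsub>X\<^esub> y) (phi (fiber_module M) x y c) =
        phi (fiber_module M) (\<rho>\<^bsub>X\<^esub> x) y (eta (fiber_module M) x c)"
      by (simp add: Y.rho_qop closed)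
  next
    fix x y b assume "x \<in> carrier X" "y \<in> carrier X" "b \<in> carrier (grp (fiber_module M) y)"
    then show "psi (fiber_module M) (\<rho>\<^bsub>X\<^esub> x) y b =
        eta (fiber_module M) (x \<star>\<^bsub>X\<^esub> y) (psi (fiber_module M) x y b)"
      by (simp add: Y.rho_qop closed rho_zero)
  next
    fix x y c assume "x \<in> carrier X" "y \<in> carrier X" "c \<in> carrier (grp (fiber_module M) x)"
    then show "phi (fiber_module M) (qinv X x y) y (phi (fiber_module M) x (\<rho>\<^bsub>X\<^esub> y) c) = c"
      using Y.qop_rho_cancel[of c "zero M y"] by (simp add: closed rho_zero)
  next
    fix x y z a
    assume *: "x \<in> carrier X" "y \<in> carrier X" "z \<in> carrier X" "a \<in> carrier (grp (fiber_module M) z)"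
    \<comment> \<open>The zero over \<open>x * y\<close> is itself a product of zeros, so
      distributivity applies and produces a product of two nonzero elements, which is then
      split.\<close>
    have "psi (fiber_module M) (x \<star>\<^bsub>X\<^esub> y) z a =
        (zero M x \<star>\<^bsub>Y\<^esub> a) \<star>\<^bsub>Y\<^esub> (zero M y \<star>\<^bsub>Y\<^esub> a)"
      using Y.qop_distrib[of "zero M x" "zero M y" a] * by (simp add: closed qop_zero)
    also have "\<dots> = add M ((zero M x \<star>\<^bsub>Y\<^esub> a) \<star>\<^bsub>Y\<^esub> zero M (y \<star>\<^bsub>X\<^esub> z),
        zero M (x \<star>\<^bsub>X\<^esub> z) \<star>\<^bsub>Y\<^esub> (zero M y \<star>\<^bsub>Y\<^esub> a))"
      using qop_split[of "zero M x \<star>\<^bsub>Y\<^esub> a" "zero M y \<star>\<^bsub>Y\<^esub> a"] * by (simp add: closed p_qop p_zero)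
    finally show "psi (fiber_module M) (x \<star>\<^bsub>X\<^esub> y) z a =
        phi (fiber_module M) (x \<star>\<^bsub>X\<^esub> z) (y \<star>\<^bsub>X\<^esub> z) (psi (fiber_module M) x z a)
          \<otimes>\<^bsub>grp (fiber_module M) ((x \<star>\<^bsub>X\<^esub> y) \<star>\<^bsub>X\<^esub> z)\<^esub>
        psi (fiber_module M) (x \<star>\<^bsub>X\<^esub> z) (y \<star>\<^bsub>X\<^esub> z) (psi (fiber_module M) y z a)"
      by simp
  next
    fix x y b
    assume *: "x \<in> carrier X" "y \<in> carrier X" "b \<in> carrier (grp (fiber_module M) y)"
    \<comment> \<open>Multiplying the zero by \<open>\<rho> b\<close> and then by \<open>b\<close>
      returns it; splitting the outer product exhibits two elements with sum zero, that is, inverse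
      to each other.\<close>
    have "zero M x = (zero M x \<star>\<^bsub>Y\<^esub> \<rho>\<^bsub>Y\<^esub> b) \<star>\<^bsub>Y\<^esub> b"
      using Y.qop_rho_cancel[of "zero M x" b] * by (simp add: closed)
    also have "\<dots> = add M ((zero M x \<star>\<^bsub>Y\<^esub> \<rho>\<^bsub>Y\<^esub> b) \<star>\<^bsub>Y\<^esub> zero M y,
        zero M (x \<star>\<^bsub>X\<^esub> \<rho>\<^bsub>X\<^esub> y) \<star>\<^bsub>Y\<^esub> b)"
      using qop_split[of "zero M x \<star>\<^bsub>Y\<^esub> \<rho>\<^bsub>Y\<^esub> b" b] * by (simp add: closed p_qop p_zero p_rho)
    finally show "phi (fiber_module M) (qinv X x y) y
          (psi (fiber_module M) x (\<rho>\<^bsub>X\<^esub> y) (eta (fiber_module M) y b)) =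
        inv\<^bsub>grp (fiber_module M) x\<^esub> (psi (fiber_module M) (x \<star>\<^bsub>X\<^esub> \<rho>\<^bsub>X\<^esub> y) y b)"
      using * by (auto intro!: inv_fiber_eqI simp: closed p_qop p_zero p_rho X.qop_rho_cancel)
  next
    fix x c assume "x \<in> carrier X" "c \<in> carrier (grp (fiber_module M) x)"
    then show "phi (fiber_module M) x x c \<otimes>\<^bsub>grp (fiber_module M) x\<^esub> psi (fiber_module M) x x c = c"
      using qop_split[of c c] Y.qop_idem[of c] by simp
  qed
qed

end


section \<open>The fibre functor\<close>

lemma Ab_cat_simps [simp]:
  "Obj (Ab_cat X) = {M. abelian_group_object X M}"
  "Hom (Ab_cat X) M N = ab_hom M N"
  "Id (Ab_cat X) M = (\<lambda>a\<in>carrier (tot (base M)). a)"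
  "Comp (Ab_cat X) M N P g f = compose (carrier (tot (base M))) g f"
  by (simp_all add: Ab_cat_def slice_cat_def)

lemma SQMod_cat_simps [simp]:
  "Obj (SQMod_cat X) = {F. sq_module X F}"
  "Hom (SQMod_cat X) F F' = sqmod_hom X F F'"
  "Id (SQMod_cat X) F = (\<lambda>x\<in>carrier X. \<lambda>a\<in>carrier (grp F x). a)"
  "Comp (SQMod_cat X) F F' F'' g f = (\<lambda>x\<in>carrier X. compose (carrier (grp F x)) (g x) (f x))"
  by (simp_all add: SQMod_cat_def)

lemma compose_restrict_id_left:
  assumes "f \<in> extensional A" "\<And>a. a \<in> A \<Longrightarrow> f a \<in> B"
  shows "compose A (\<lambda>b\<in>B. b) f = f"
  using assms by (intro extensionalityI[of _ A]) (auto simp: compose_def)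

lemma compose_restrict_id_right:
  assumes "f \<in> extensional A"
  shows "compose A f (\<lambda>a\<in>A. a) = f"
  using assms by (intro extensionalityI[of _ A]) (auto simp: compose_def)

lemma category_Ab_cat: "category (Ab_cat X)"
proof
  fix M assume "M \<in> Obj (Ab_cat X)"
  then interpret abelian_group_object X M by simp
  show "Id (Ab_cat X) M \<in> Hom (Ab_cat X) M M"
    by (simp, rule ab_homI) (auto simp: Y.qop_closed Y.rho_closed add_closed)
next
  fix M N P f g
  assume "M \<in> Obj (Ab_cat X)" "f \<in> Hom (Ab_cat X) M N" "g \<in> Hom (Ab_cat X) N P"
  then interpret abelian_group_object X M by simp
  note f = ab_homD[OF \<open>f \<in> Hom (Ab_cat X) M N\<close>[simplified]]
    and g = ab_homD[OF \<open>g \<in> Hom (Ab_cat X) N P\<close>[simplified]]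
  show "Comp (Ab_cat X) M N P g f \<in> Hom (Ab_cat X) M P"
    by (simp, rule ab_homI)
      (auto simp: compose_def Y.qop_closed Y.rho_closed add_closed f(2-) g(2-))
next
  fix M N P Q f g h
  assume "f \<in> Hom (Ab_cat X) M N"
  then show "Comp (Ab_cat X) M N Q (Comp (Ab_cat X) N P Q h g) f =
      Comp (Ab_cat X) M P Q h (Comp (Ab_cat X) M N P g f)"
    by (auto simp: compose_def fun_eq_iff dest: ab_homD(2))
qed (auto intro: compose_restrict_id_left compose_restrict_id_right dest: ab_homD(1,2))

lemma sqmod_hom_closed:
  "\<lbrakk>f \<in> sqmod_hom X F F'; x \<in> carrier X; a \<in> carrier (grp F x)\<rbrakk> \<Longrightarrow> f x a \<in> carrier (grp F' x)"
  by (rule hom_in_carrier[OF sqmod_homD(2)])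

lemma sqmod_hom_mult:
  "\<lbrakk>f \<in> sqmod_hom X F F'; x \<in> carrier X; a \<in> carrier (grp F x); b \<in> carrier (grp F x)\<rbrakk>
    \<Longrightarrow> f x (a \<otimes>\<^bsub>grp F x\<^esub> b) = f x a \<otimes>\<^bsub>grp F' x\<^esub> f x b"
  by (rule hom_mult[OF sqmod_homD(2)])

context sq_module
begin

lemma
  assumes "x \<in> carrier X" "y \<in> carrier X"
  shows phi_closed: "a \<in> carrier (grp F x) \<Longrightarrow> phi F x y a \<in> carrier (grp F (x \<star> y))"
    and psi_closed: "b \<in> carrier (grp F y) \<Longrightarrow> psi F x y b \<in> carrier (grp F (x \<star> y))"
  using phi_iso[OF assms] psi_hom[OF assms] by (auto simp: iso_def hom_def)

lemma eta_closed:
  "\<lbrakk>x \<in> carrier X; a \<in> carrier (grp F x)\<rbrakk> \<Longrightarrow> eta F x a \<in> carrier (grp F (\<rho> x))"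
  using eta_hom by (auto simp: hom_def)

end

lemma category_SQMod_cat:
  assumes "sym_quandle X"
  shows "category (SQMod_cat X)"
proof
  fix F assume "F \<in> Obj (SQMod_cat X)"
  then interpret sq_module X F by simp
  have "(\<lambda>a\<in>carrier (grp F x). a) \<in> hom (grp F x) (grp F x)" if "x \<in> carrier X" for x
  proof -
    interpret comm_group "grp F x" by (rule grp_comm_group[OF that])
    show ?thesis by (rule homI) auto
  qed
  then show "Id (SQMod_cat X) F \<in> Hom (SQMod_cat X) F F"
    by (simp, intro sqmod_homI) (auto simp: phi_closed psi_closed eta_closed qop_closed rho_closed)
next
  fix F F' F'' f g
  assume "F \<in> Obj (SQMod_cat X)" "f \<in> Hom (SQMod_cat X) F F'" "g \<in> Hom (SQMod_cat X) F' F''"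
  then interpret sq_module X F by simp
  have f: "f \<in> sqmod_hom X F F'" and g: "g \<in> sqmod_hom X F' F''"
    using \<open>f \<in> Hom (SQMod_cat X) F F'\<close> \<open>g \<in> Hom (SQMod_cat X) F' F''\<close> by simp_all
  note fg_closed = sqmod_hom_closed[OF f] sqmod_hom_closed[OF g]
  have "compose (carrier (grp F x)) (g x) (f x) \<in> hom (grp F x) (grp F'' x)"
    if x: "x \<in> carrier X" for x
  proof -
    interpret comm_group "grp F x" by (rule grp_comm_group[OF x])
    show ?thesis
      by (rule homI) (auto simp: compose_def x fg_closed sqmod_hom_mult[OF f] sqmod_hom_mult[OF g])
  qed
  then show "Comp (SQMod_cat X) F F' F'' g f \<in> Hom (SQMod_cat X) F F''"
    by (simp, intro sqmod_homI)
      (auto simp: compose_def phi_closed psi_closed eta_closed qop_closed rho_closed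
        fg_closed sqmod_homD(4-6)[OF f] sqmod_homD(4-6)[OF g])
next
  fix F F' f assume f: "f \<in> Hom (SQMod_cat X) F F'"
  then have f': "f \<in> sqmod_hom X F F'" by simp
  show "Comp (SQMod_cat X) F F F' f (Id (SQMod_cat X) F) = f"
    using sqmod_homD(1,3)[OF f']
    by (intro extensionalityI[of _ "carrier X"]) (auto simp: compose_restrict_id_right)
  show "Comp (SQMod_cat X) F F' F' (Id (SQMod_cat X) F') f = f"
    using sqmod_homD(1,3)[OF f'] sqmod_hom_closed[OF f']
    by (intro extensionalityI[of _ "carrier X"]) (auto simp: compose_restrict_id_left)
next
  fix F F' F'' F''' f g h
  assume f: "f \<in> Hom (SQMod_cat X) F F'"
  then show "Comp (SQMod_cat X) F F' F''' (Comp (SQMod_cat X) F' F'' F''' h g) f =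
      Comp (SQMod_cat X) F F'' F''' h (Comp (SQMod_cat X) F F' F'' g f)"
    by (auto simp: compose_def fun_eq_iff sqmod_hom_closed)
qed

section \<open>Restriction of morphisms to fibres\<close>

text \<open>The family is restricted in the index and in the group element because
  \<open>sqmod_hom\<close> demands extensionality in both.\<close>

definition fiber_functor ::
  "'x sym_quandle
    \<Rightarrow> (('x, 'u) ab_object, 'u \<Rightarrow> 'u, ('x, 'u) sq_module, 'x \<Rightarrow> 'u \<Rightarrow> 'u) cat_functor" where
  "fiber_functor X =
    \<lparr>fobj = fiber_module,
     fmor = (\<lambda>M N h. \<lambda>x\<in>carrier X. \<lambda>a\<in>carrier (fiber_grp M x). h a)\<rparr>"

lemma fiber_functor_simps [simp]:
  "fobj (fiber_functor X) M = fiber_module M"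
  "fmor (fiber_functor X) M N h = (\<lambda>x\<in>carrier X. \<lambda>a\<in>carrier (fiber_grp M x). h a)"
  by (simp_all add: fiber_functor_def)

text \<open>Morphisms are only required to respect addition, but the image of a zero is idempotent
  in a fibre group and so is its unit. This is what lets them commute with \<open>phi\<close> and
  \<open>psi\<close>, which are products with zeros.\<close>

lemma ab_hom_zero:
  assumes "abelian_group_object X M" "abelian_group_object X N" and h: "h \<in> ab_hom M N"
    and x: "x \<in> carrier X"
  shows "h (zero M x) = zero N x"
proof -
  interpret M: abelian_group_object X M by fact
  interpret N: abelian_group_object X N by fact
  interpret comm_group "fiber_grp N x" by (rule N.comm_group_fiber[OF x])
  let ?u = "h (zero M x)"
  note z = M.zero_closed[OF x] M.p_zero[OF x]
  have u: "?u \<in> carrier (fiber_grp N x)"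
    using ab_homD(2,5)[OF h] z by simp
  have "add N (?u, ?u) = ?u"
    using ab_homD(6)[OF h z(1) z(1)] M.add_zero_left[OF z(1)] z by simp
  then show ?thesis
    using r_cancel_one[OF u u] by simp
qed

lemma fiber_functor_hom:
  assumes "sym_quandle X"
    and "abelian_group_object X M" "abelian_group_object X N" and h: "h \<in> ab_hom M N"
  shows "fmor (fiber_functor X) M N h \<in> sqmod_hom X (fiber_module M) (fiber_module N)"
proof -
  interpret X: sym_quandle X by fact
  interpret M: abelian_group_object X M by fact
  interpret N: abelian_group_object X N by fact
  note hD = ab_homD(2-)[OF h] and h0 = ab_hom_zero[OF assms(2-4)]
  have "(\<lambda>a\<in>carrier (fiber_grp M x). h a) \<in> hom (fiber_grp M x) (fiber_grp N x)"
    if "x \<in> carrier X" for x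
    by (rule homI) (auto simp: hD M.add_closed M.p_add)
  then show ?thesis
    by (simp, intro sqmod_homI)
      (auto simp: hD h0 X.qop_closed X.rho_closed M.Y.qop_closed M.Y.rho_closed M.zero_closed
        M.p_zero M.p_qop M.p_rho)
qed

lemma cat_functor_fiber_functor:
  assumes "sym_quandle X"
  shows "cat_functor (Ab_cat X) (SQMod_cat X) (fiber_functor X)"
proof
  fix M assume "M \<in> Obj (Ab_cat X)"
  then show "fobj (fiber_functor X) M \<in> Obj (SQMod_cat X)"
    using abelian_group_object.sq_module_fiber_module[OF _ assms] by simp
next
  fix M N f assume "M \<in> Obj (Ab_cat X)" "N \<in> Obj (Ab_cat X)" "f \<in> Hom (Ab_cat X) M N"
  then show "fmor (fiber_functor X) M N f
      \<in> Hom (SQMod_cat X) (fobj (fiber_functor X) M) (fobj (fiber_functor X) N)"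
    using fiber_functor_hom[OF assms] by simp
qed (auto simp: compose_def fun_eq_iff dest: ab_homD(2,5))

text \<open>The fibres partition the total set, so restricting to fibres and gluing along
  \<open>proj\<close> are mutually inverse for purely set-theoretic reasons. What remains is that a
  glued module homomorphism respects the structure.\<close>

lemma fully_faithful_fiber_functor:
  assumes "sym_quandle X" and "abelian_group_object X M" "abelian_group_object X N"
  shows "bij_betw (fmor (fiber_functor X) M N) (ab_hom M N)
    (sqmod_hom X (fiber_module M) (fiber_module N))"
proof (rule bij_betw_byWitness[where
    f' = "\<lambda>f. \<lambda>a\<in>carrier (tot (base M)). f (proj (base M) a) a"])
  interpret X: sym_quandle X by fact
  interpret M: abelian_group_object X M by fact
  interpret N: abelian_group_object X N by fact
  show "fmor (fiber_functor X) M N ` ab_hom M N \<subseteq> sqmod_hom X (fiber_module M) (fiber_module N)"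
    using fiber_functor_hom[OF assms] by blast
  show "\<forall>h\<in>ab_hom M N.
      (\<lambda>a\<in>carrier M.Y. fmor (fiber_functor X) M N h (M.p a) a) = h"
  proof
    fix h assume "h \<in> ab_hom M N"
    then show "(\<lambda>a\<in>carrier M.Y. fmor (fiber_functor X) M N h (M.p a) a) = h"
      using ab_homD(1) by (intro extensionalityI[of _ "carrier M.Y"]) (auto simp: M.p_closed)
  qed
  show "\<forall>f\<in>sqmod_hom X (fiber_module M) (fiber_module N).
      fmor (fiber_functor X) M N (\<lambda>a\<in>carrier M.Y. f (M.p a) a) = f"
  proof
    fix f assume f: "f \<in> sqmod_hom X (fiber_module M) (fiber_module N)"
    show "fmor (fiber_functor X) M N (\<lambda>a\<in>carrier M.Y. f (M.p a) a) = f"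
    proof (rule extensionalityI[of _ "carrier X"])
      fix x assume x: "x \<in> carrier X"
      show "fmor (fiber_functor X) M N (\<lambda>a\<in>carrier M.Y. f (M.p a) a) x = f x"
        using sqmod_homD(3)[OF f x] x
        by (intro extensionalityI[of _ "carrier (fiber_grp M x)"]) auto
    qed (use sqmod_homD(1)[OF f] in auto)
  qed
  show "(\<lambda>f. \<lambda>a\<in>carrier M.Y. f (M.p a) a) ` sqmod_hom X (fiber_module M) (fiber_module N)
      \<subseteq> ab_hom M N"
  proof (intro image_subsetI ab_homI)
    fix f assume f: "f \<in> sqmod_hom X (fiber_module M) (fiber_module N)"
    have f_closed: "f x a \<in> carrier N.Y" "N.p (f x a) = x"
      if "x \<in> carrier X" "a \<in> carrier M.Y" "M.p a = x" for x a
      using sqmod_hom_closed[OF f, of x a] that by simp_all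
    note f_mult = sqmod_hom_mult[OF f, simplified]
      and f_phi = sqmod_homD(4)[OF f, simplified]
      and f_psi = sqmod_homD(5)[OF f, simplified]
      and f_eta = sqmod_homD(6)[OF f, simplified]
    note closed = M.Y.qop_closed M.Y.rho_closed M.p_closed M.zero_closed M.add_closed
    fix a assume a: "a \<in> carrier M.Y"
    show "(\<lambda>a\<in>carrier M.Y. f (M.p a) a) a \<in> carrier N.Y"
      "N.p ((\<lambda>a\<in>carrier M.Y. f (M.p a) a) a) = M.p a"
      using a by (simp_all add: f_closed closed)
    show "(\<lambda>a\<in>carrier M.Y. f (M.p a) a) (\<rho>\<^bsub>M.Y\<^esub> a) =
        \<rho>\<^bsub>N.Y\<^esub> ((\<lambda>a\<in>carrier M.Y. f (M.p a) a) a)"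
      using a f_eta[of "M.p a" a] by (simp add: closed M.p_rho)
    fix b assume b: "b \<in> carrier M.Y"
    let ?x = "M.p a" and ?y = "M.p b"
    \<comment> \<open>The product is split in \<open>M\<close>, the summands are handled by
      additivity of \<open>f\<close> in one fibre and by its compatibility with \<open>phi\<close>
      and \<open>psi\<close>, and the result is reassembled in \<open>N\<close>.\<close>
    have "f (?x \<star>\<^bsub>X\<^esub> ?y) (a \<star>\<^bsub>M.Y\<^esub> b) =
        add N (f (?x \<star>\<^bsub>X\<^esub> ?y) (a \<star>\<^bsub>M.Y\<^esub> zero M ?y), f (?x \<star>\<^bsub>X\<^esub> ?y) (zero M ?x \<star>\<^bsub>M.Y\<^esub> b))"
      using f_mult[of "?x \<star>\<^bsub>X\<^esub> ?y" "a \<star>\<^bsub>M.Y\<^esub> zero M ?y" "zero M ?x \<star>\<^bsub>M.Y\<^esub> b"] a b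
      by (simp add: M.qop_split[OF a b] closed M.p_qop M.p_zero X.qop_closed)
    also have "\<dots> = add N (f ?x a \<star>\<^bsub>N.Y\<^esub> zero N ?y, zero N ?x \<star>\<^bsub>N.Y\<^esub> f ?y b)"
      using f_phi[of ?x ?y a] f_psi[of ?x ?y b] a b by (simp add: closed)
    also have "\<dots> = f ?x a \<star>\<^bsub>N.Y\<^esub> f ?y b"
      using N.qop_split[of "f ?x a" "f ?y b"] a b by (simp add: f_closed closed)
    finally show "(\<lambda>a\<in>carrier M.Y. f (M.p a) a) (a \<star>\<^bsub>M.Y\<^esub> b) =
        (\<lambda>a\<in>carrier M.Y. f (M.p a) a) a \<star>\<^bsub>N.Y\<^esub> (\<lambda>a\<in>carrier M.Y. f (M.p a) a) b"
      using a b by (simp add: closed M.p_qop)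
    assume "?x = ?y"
    then show "(\<lambda>a\<in>carrier M.Y. f (M.p a) a) (add M (a, b)) =
        add N ((\<lambda>a\<in>carrier M.Y. f (M.p a) a) a, (\<lambda>a\<in>carrier M.Y. f (M.p a) a) b)"
      using a b f_mult[of ?y a b] by (simp add: closed M.p_add)
  qed auto
qed


section \<open>The total object of a module\<close>

context sq_module
begin

text \<open>The product \<open>(x, a) * (y, b)\<close> in the disjoint union of the \<open>A\<^sub>x\<close> lies over \<open>x * y\<close>; this is its
  second component.\<close>

definition tot_op :: "'x \<Rightarrow> 'x \<Rightarrow> 'u \<Rightarrow> 'u \<Rightarrow> 'u" where
  "tot_op x y a b = phi F x y a \<otimes>\<^bsub>grp F (x \<star> y)\<^esub> psi F x y b"

section \<open>Quandle laws for the operation on pairs\<close>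

lemma phi_mult:
  "\<lbrakk>x \<in> carrier X; y \<in> carrier X; a \<in> carrier (grp F x); b \<in> carrier (grp F x)\<rbrakk>
    \<Longrightarrow> phi F x y (a \<otimes>\<^bsub>grp F x\<^esub> b) = phi F x y a \<otimes>\<^bsub>grp F (x \<star> y)\<^esub> phi F x y b"
  using phi_iso[of x y] by (simp add: iso_def hom_def)

lemma psi_mult:
  "\<lbrakk>x \<in> carrier X; y \<in> carrier X; a \<in> carrier (grp F y); b \<in> carrier (grp F y)\<rbrakk>
    \<Longrightarrow> psi F x y (a \<otimes>\<^bsub>grp F y\<^esub> b) = psi F x y a \<otimes>\<^bsub>grp F (x \<star> y)\<^esub> psi F x y b"
  using psi_hom[of x y] by (simp add: hom_def)

lemma eta_mult:
  "\<lbrakk>x \<in> carrier X; a \<in> carrier (grp F x); b \<in> carrier (grp F x)\<rbrakk>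
    \<Longrightarrow> eta F x (a \<otimes>\<^bsub>grp F x\<^esub> b) = eta F x a \<otimes>\<^bsub>grp F (\<rho> x)\<^esub> eta F x b"
  using eta_hom[of x] by (simp add: hom_def)

lemma grp_group: "x \<in> carrier X \<Longrightarrow> group (grp F x)"
  using grp_comm_group comm_group.axioms(2) by blast

lemma phi_one:
  "\<lbrakk>x \<in> carrier X; y \<in> carrier X\<rbrakk> \<Longrightarrow> phi F x y \<one>\<^bsub>grp F x\<^esub> = \<one>\<^bsub>grp F (x \<star> y)\<^esub>"
  using hom_one[of "phi F x y" "grp F x" "grp F (x \<star> y)"] phi_iso[of x y] qop_closed grp_group
  by (simp add: iso_def)

lemma psi_one:
  "\<lbrakk>x \<in> carrier X; y \<in> carrier X\<rbrakk> \<Longrightarrow> psi F x y \<one>\<^bsub>grp F y\<^esub> = \<one>\<^bsub>grp F (x \<star> y)\<^esub>"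
  using hom_one[of "psi F x y" "grp F y" "grp F (x \<star> y)"] psi_hom[of x y] qop_closed grp_group
  by simp

lemma eta_one:
  "x \<in> carrier X \<Longrightarrow> eta F x \<one>\<^bsub>grp F x\<^esub> = \<one>\<^bsub>grp F (\<rho> x)\<^esub>"
  using hom_one[of "eta F x" "grp F x" "grp F (\<rho> x)"] eta_hom[of x] rho_closed grp_group by simp

context
  fixes x y a b
  assumes x: "x \<in> carrier X" and y: "y \<in> carrier X"
    and a: "a \<in> carrier (grp F x)" and b: "b \<in> carrier (grp F y)"
begin

interpretation xy: comm_group "grp F (x \<star> y)"
  using grp_comm_group qop_closed x y by blast

lemma tot_op_closed: "tot_op x y a b \<in> carrier (grp F (x \<star> y))"
  unfolding tot_op_def using x y a b phi_closed psi_closed by simp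

text \<open>The interchange law, which will make addition a quandle homomorphism: \<open>phi\<close>
  and \<open>psi\<close> are additive, and commutativity of the group over \<open>x * y\<close> lets
  the middle terms change places.\<close>

lemma tot_op_mult:
  assumes a': "a' \<in> carrier (grp F x)" and b': "b' \<in> carrier (grp F y)"
  shows "tot_op x y (a \<otimes>\<^bsub>grp F x\<^esub> a') (b \<otimes>\<^bsub>grp F y\<^esub> b') =
    tot_op x y a b \<otimes>\<^bsub>grp F (x \<star> y)\<^esub> tot_op x y a' b'"
  unfolding tot_op_def using x y a b a' b'
  by (simp add: phi_mult psi_mult phi_closed psi_closed xy.m_ac)

text \<open>The involution falls on \<open>a\<close> alone, as in \<open>rho_qop\<close>:
  \<open>eta_phi\<close> moves it inside the first summand, while in the second
  \<open>psi_rho\<close> absorbs it into the index.\<close>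

lemma eta_tot_op: "eta F (x \<star> y) (tot_op x y a b) = tot_op (\<rho> x) y (eta F x a) b"
  unfolding tot_op_def using x y a b
  by (simp add: eta_mult eta_phi psi_rho phi_closed psi_closed qop_closed rho_qop)

text \<open>Both sides are sums of contributions of \<open>a\<close>, \<open>b\<close> and
  \<open>c\<close>, which agree separately by \<open>phi_phi\<close>, \<open>phi_psi\<close> and
  \<open>psi_split\<close>; \<open>c\<close> contributes twice on the right, whence the two terms of
  \<open>psi_split\<close>.\<close>

lemma tot_op_distrib:
  assumes z: "z \<in> carrier X" and c: "c \<in> carrier (grp F z)"
  shows "tot_op (x \<star> y) z (tot_op x y a b) c =
    tot_op (x \<star> z) (y \<star> z) (tot_op x z a c) (tot_op y z b c)"
proof -
  let ?G = "grp F ((x \<star> z) \<star> (y \<star> z))"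
  interpret G: comm_group ?G
    using grp_comm_group qop_closed x y z by blast
  \<comment> \<open>The two sides live over the same index written in two ways; one form is fixed so
    that all sums are taken in \<open>?G\<close>.\<close>
  have xyz: "(x \<star> y) \<star> z = (x \<star> z) \<star> (y \<star> z)"
    using qop_distrib x y z by blast
  note closed = x y z a b c qop_closed phi_closed psi_closed
  have closed_G: "phi F (x \<star> z) (y \<star> z) (phi F x z a) \<in> carrier ?G"
    "phi F (x \<star> z) (y \<star> z) (psi F x z c) \<in> carrier ?G"
    "psi F (x \<star> z) (y \<star> z) (phi F y z b) \<in> carrier ?G"
    "psi F (x \<star> z) (y \<star> z) (psi F y z c) \<in> carrier ?G"
    by (simp_all add: closed)
  have "tot_op (x \<star> y) z (tot_op x y a b) c =
      (phi F (x \<star> y) z (phi F x y a) \<otimes>\<^bsub>?G\<^esub> phi F (x \<star> y) z (psi F x y b)) \<otimes>\<^bsub>?G\<^esub> psi F (x \<star> y) z c"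
    unfolding tot_op_def by (simp add: phi_mult closed flip: xyz)
  also have "\<dots> =
      (phi F (x \<star> z) (y \<star> z) (phi F x z a) \<otimes>\<^bsub>?G\<^esub> psi F (x \<star> z) (y \<star> z) (phi F y z b)) \<otimes>\<^bsub>?G\<^esub>
      (phi F (x \<star> z) (y \<star> z) (psi F x z c) \<otimes>\<^bsub>?G\<^esub> psi F (x \<star> z) (y \<star> z) (psi F y z c))"
    using phi_phi[OF x y z a] phi_psi[OF x y z b] psi_split[OF x y z c] xyz by simp
  also have "\<dots> = tot_op (x \<star> z) (y \<star> z) (tot_op x z a c) (tot_op y z b c)"
    unfolding tot_op_def using closed_G by (simp add: phi_mult psi_mult closed G.m_ac)
  finally show ?thesis .
qed

text \<open>By \<open>phi_phi_rho\<close> the contribution of \<open>a\<close> comes back as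
  \<open>a\<close>, and by \<open>phi_psi_rho\<close> the inner contribution of \<open>b\<close> is
  the inverse of the outer one.\<close>

lemma tot_op_rho_cancel: "tot_op (x \<star> \<rho> y) y (tot_op x (\<rho> y) a (eta F y b)) b = a"
proof -
  interpret x: comm_group "grp F x" by (rule grp_comm_group[OF x])
  have xyy: "(x \<star> \<rho> y) \<star> y = x"
    using qop_rho_cancel x y .
  have xy: "x \<star> \<rho> y \<in> carrier X"
    using x y qop_closed rho_closed by blast
  have qinv: "qinv X x y = x \<star> \<rho> y"
    using qop_rho x y by simp
  let ?c = "psi F (x \<star> \<rho> y) y b"
  have c: "?c \<in> carrier (grp F x)"
    using psi_closed[OF xy y b] xyy by simp
  have "phi F (x \<star> \<rho> y) y (tot_op x (\<rho> y) a (eta F y b)) = a \<otimes>\<^bsub>grp F x\<^esub> inv\<^bsub>grp F x\<^esub> ?c"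
    unfolding tot_op_def
    using phi_phi_rho[OF x y a] phi_psi_rho[OF x y b] x y a b xyy xy
    by (simp add: qinv phi_mult phi_closed psi_closed eta_closed rho_closed)
  then show ?thesis
    using c a by (simp add: tot_op_def xyy x.m_assoc)
qed

end

lemma tot_op_idem: "\<lbrakk>x \<in> carrier X; a \<in> carrier (grp F x)\<rbrakk> \<Longrightarrow> tot_op x x a a = a"
  unfolding tot_op_def using phi_psi_diag qop_idem by simp

text \<open>Multiplying by a zero returns \<open>phi\<close>, and on the other side
  \<open>psi\<close>, which is how the fibre module reads its maps off the operation. Hence the
  fibre module of the total object gives back \<open>F\<close>.\<close>

lemma tot_op_one_right:
  assumes "x \<in> carrier X" "y \<in> carrier X" "a \<in> carrier (grp F x)"
  shows "tot_op x y a \<one>\<^bsub>grp F y\<^esub> = phi F x y a"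
proof -
  interpret comm_group "grp F (x \<star> y)"
    using grp_comm_group qop_closed assms by blast
  show ?thesis
    using assms by (simp add: tot_op_def psi_one phi_closed)
qed

lemma tot_op_one_left:
  assumes "x \<in> carrier X" "y \<in> carrier X" "b \<in> carrier (grp F y)"
  shows "tot_op x y \<one>\<^bsub>grp F x\<^esub> b = psi F x y b"
proof -
  interpret comm_group "grp F (x \<star> y)"
    using grp_comm_group qop_closed assms by blast
  show ?thesis
    using assms by (simp add: tot_op_def phi_one psi_closed)
qed

text \<open>By \<open>tot_op_mult\<close> the two values multiply to \<open>tot_op\<close> of two
  units, which is a unit. This and \<open>eta_inv\<close> make negation a morphism.\<close>

lemma tot_op_inv:
  assumes "x \<in> carrier X" "y \<in> carrier X" "a \<in> carrier (grp F x)" "b \<in> carrier (grp F y)"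
  shows "tot_op x y (inv\<^bsub>grp F x\<^esub> a) (inv\<^bsub>grp F y\<^esub> b) = inv\<^bsub>grp F (x \<star> y)\<^esub> (tot_op x y a b)"
proof -
  interpret x: comm_group "grp F x" using grp_comm_group assms by blast
  interpret y: comm_group "grp F y" using grp_comm_group assms by blast
  interpret xy: comm_group "grp F (x \<star> y)" using grp_comm_group qop_closed assms by blast
  show ?thesis
    using tot_op_mult[of x y "inv\<^bsub>grp F x\<^esub> a" "inv\<^bsub>grp F y\<^esub> b" a b] assms
    by (intro xy.inv_equality[symmetric]) (simp_all add: tot_op_closed tot_op_one_left psi_one)
qed

lemma eta_inv:
  assumes "x \<in> carrier X" "a \<in> carrier (grp F x)"
  shows "eta F x (inv\<^bsub>grp F x\<^esub> a) = inv\<^bsub>grp F (\<rho> x)\<^esub> (eta F x a)"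
proof -
  interpret group_hom "grp F x" "grp F (\<rho> x)" "eta F x"
    using assms by (simp add: group_hom_def group_hom_axioms_def grp_group rho_closed eta_hom)
  show ?thesis using assms by simp
qed

end

section \<open>The disjoint union of the groups inside the universe\<close>

text \<open>
  The objects of the slice category live in the type \<open>'u\<close>, so the disjoint union of the \<open>A\<^sub>x\<close> is
  formed inside \<open>'u\<close> by means of an injection \<open>code\<close> of pairs.
\<close>

locale encoded_sq_module = sq_module X F
  for X :: "'x sym_quandle" (structure) and F :: "('x, 'u) sq_module" +
  fixes code :: "'x \<Rightarrow> 'u \<Rightarrow> 'u" and ix :: "'u \<Rightarrow> 'x" and val :: "'u \<Rightarrow> 'u"
  assumes ix_code [simp]: "x \<in> carrier X \<Longrightarrow> ix (code x a) = x"
    and val_code [simp]: "x \<in> carrier X \<Longrightarrow> val (code x a) = a"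
begin

lemma code_inject [simp]:
  assumes "x \<in> carrier X" "y \<in> carrier X"
  shows "code x a = code y b \<longleftrightarrow> x = y \<and> a = b"
  using assms ix_code val_code by metis

definition total_quandle :: "'u sym_quandle" where
  "total_quandle =
    \<lparr>carrier = {code x a |x a. x \<in> carrier X \<and> a \<in> carrier (grp F x)},
     qop = (\<lambda>u v. code (ix u \<star> ix v) (tot_op (ix u) (ix v) (val u) (val v))),
     rho = (\<lambda>u. code (\<rho> (ix u)) (eta F (ix u) (val u)))\<rparr>"

text \<open>Nothing is assumed about \<open>ix\<close> and \<open>val\<close> away from codes, so
  computations in the total quandle start by writing the arguments in this form.\<close>

lemma total_quandle_cases:
  assumes "u \<in> carrier total_quandle"
  obtains x a where "u = code x a" "x \<in> carrier X" "a \<in> carrier (grp F x)"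
  using assms by (auto simp: total_quandle_def)

lemma code_in_total [simp]:
  assumes "x \<in> carrier X"
  shows "code x a \<in> carrier total_quandle \<longleftrightarrow> a \<in> carrier (grp F x)"
  using assms by (auto simp: total_quandle_def)

lemma total_quandle_ops [simp]:
  "x \<in> carrier X \<Longrightarrow> y \<in> carrier X
    \<Longrightarrow> code x a \<star>\<^bsub>total_quandle\<^esub> code y b = code (x \<star> y) (tot_op x y a b)"
  "x \<in> carrier X \<Longrightarrow> \<rho>\<^bsub>total_quandle\<^esub> (code x a) = code (\<rho> x) (eta F x a)"
  by (simp_all add: total_quandle_def)

lemma sym_quandle_total: "sym_quandle total_quandle"
proof (rule sym_quandleI; (elim total_quandle_cases)?)
  fix u v w x y z a b c
  assume "u = code x a" "v = code y b" "w = code z c"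
    and x: "x \<in> carrier X" and y: "y \<in> carrier X" and z: "z \<in> carrier X"
    and "a \<in> carrier (grp F x)" "b \<in> carrier (grp F y)" "c \<in> carrier (grp F z)"
  then show "(u \<star>\<^bsub>total_quandle\<^esub> v) \<star>\<^bsub>total_quandle\<^esub> w =
      (u \<star>\<^bsub>total_quandle\<^esub> w) \<star>\<^bsub>total_quandle\<^esub> (v \<star>\<^bsub>total_quandle\<^esub> w)"
    using qop_distrib[OF x y z] by (simp add: qop_closed tot_op_distrib)
qed (simp_all add: qop_closed rho_closed qop_idem rho_rho rho_qop qop_rho_cancel
    tot_op_closed eta_closed tot_op_idem eta_eta eta_tot_op tot_op_rho_cancel)

definition total_slice :: "('x, 'u) slice" where
  "total_slice = (total_quandle, \<lambda>u\<in>carrier total_quandle. ix u)"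

definition total_object :: "('x, 'u) ab_object" where
  "total_object =
    \<lparr>base = total_slice,
     add = (\<lambda>(u, v)\<in>pullback_carrier total_slice total_slice.
       code (ix u) (val u \<otimes>\<^bsub>grp F (ix u)\<^esub> val v)),
     zero = (\<lambda>x\<in>carrier X. code x \<one>\<^bsub>grp F x\<^esub>),
     neg = (\<lambda>u\<in>carrier total_quandle. code (ix u) (inv\<^bsub>grp F (ix u)\<^esub> (val u)))\<rparr>"

lemma total_object_simps [simp]:
  "tot (base total_object) = total_quandle"
  "base total_object = total_slice"
  "tot total_slice = total_quandle"
  "u \<in> carrier total_quandle \<Longrightarrow> proj total_slice u = ix u"
  "x \<in> carrier X \<Longrightarrow> a \<in> carrier (grp F x) \<Longrightarrow> b \<in> carrier (grp F x)
    \<Longrightarrow> add total_object (code x a, code x b) = code x (a \<otimes>\<^bsub>grp F x\<^esub> b)"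
  "x \<in> carrier X \<Longrightarrow> zero total_object x = code x \<one>\<^bsub>grp F x\<^esub>"
  "x \<in> carrier X \<Longrightarrow> a \<in> carrier (grp F x)
    \<Longrightarrow> neg total_object (code x a) = code x (inv\<^bsub>grp F x\<^esub> a)"
  by (simp_all add: total_object_def total_slice_def pullback_carrier_def)

lemma total_pullback_cases:
  assumes "w \<in> pullback_carrier total_slice total_slice"
  obtains x a b where "w = (code x a, code x b)" "x \<in> carrier X"
    "a \<in> carrier (grp F x)" "b \<in> carrier (grp F x)"
proof -
  obtain u v where "w = (u, v)" "u \<in> carrier total_quandle" "v \<in> carrier total_quandle" "ix u = ix v"
    using assms by (auto simp: pullback_carrier_def)
  then show ?thesis
    using that by (elim total_quandle_cases) auto
qed

lemma total_slice_obj: "total_slice \<in> slice_obj X"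
proof -
  have "proj total_slice \<in> sq_hom total_quandle X"
    unfolding sq_hom_def total_slice_def
    by (auto simp: qop_closed rho_closed tot_op_closed eta_closed elim!: total_quandle_cases)
  then show ?thesis
    using sym_quandle_total by (simp add: slice_obj_def)
qed

lemma total_pullback_iff [simp]:
  "\<lbrakk>x \<in> carrier X; y \<in> carrier X\<rbrakk> \<Longrightarrow>
    (code x a, code y b) \<in> pullback_carrier total_slice total_slice \<longleftrightarrow>
      x = y \<and> a \<in> carrier (grp F x) \<and> b \<in> carrier (grp F x)"
  by (auto simp: pullback_carrier_def)

text \<open>On codes the group axioms become those of a single \<open>grp F x\<close>, and the
  homomorphism conditions become compatibility of \<open>tot_op\<close> and \<open>eta\<close> with
  products, units and inverses.\<close>

lemma abelian_group_object_total: "abelian_group_object X total_object"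
proof
  have prod_simps: "carrier (tot (slice_prod total_slice total_slice)) =
      pullback_carrier total_slice total_slice"
    "qop (tot (slice_prod total_slice total_slice)) (u, v) (u', v') =
      (u \<star>\<^bsub>total_quandle\<^esub> u', v \<star>\<^bsub>total_quandle\<^esub> v')"
    "rho (tot (slice_prod total_slice total_slice)) (u, v) =
      (\<rho>\<^bsub>total_quandle\<^esub> u, \<rho>\<^bsub>total_quandle\<^esub> v)"
    "(u, v) \<in> pullback_carrier total_slice total_slice \<Longrightarrow>
      proj (slice_prod total_slice total_slice) (u, v) = proj total_slice u" for u v u' v'
    by (simp_all add: slice_prod_def)
  have comm: "comm_monoid (grp F x)" "group (grp F x)" if "x \<in> carrier X" for x
    using grp_comm_group[OF that] by (simp_all add: comm_group_def)
  note mult_closed = monoid.m_closed[OF comm_monoid.axioms(1)[OF comm(1)]]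
    and one_closed = monoid.one_closed[OF comm_monoid.axioms(1)[OF comm(1)]]
    and inv_closed = group.inv_closed[OF comm(2)]
  note closed = qop_closed rho_closed tot_op_closed eta_closed mult_closed one_closed inv_closed
  show "base total_object \<in> slice_obj X"
    using total_slice_obj by simp
  \<comment> \<open>Extensionality is read off the definition, since the simplification rules
    describe \<open>add total_object\<close> only on codes.\<close>
  have "add total_object \<in> extensional (pullback_carrier total_slice total_slice)"
    by (simp add: total_object_def)
  then show "add total_object
      \<in> slice_hom (slice_prod (base total_object) (base total_object)) (base total_object)"
    unfolding slice_hom_def sq_hom_def
    by (auto simp: prod_simps PiE_def closed tot_op_mult eta_mult elim!: total_pullback_cases)
  have "zero total_object \<in> extensional (carrier X)"
    by (simp add: total_object_def)
  then show "zero total_object \<in> slice_hom (slice_terminal X) (base total_object)"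
    unfolding slice_hom_def sq_hom_def slice_terminal_def
    by (auto simp: PiE_def closed tot_op_one_left psi_one eta_one)
  have "neg total_object \<in> extensional (carrier total_quandle)"
    by (simp add: total_object_def)
  then show "neg total_object \<in> slice_hom (base total_object) (base total_object)"
    unfolding slice_hom_def sq_hom_def
    by (auto simp: PiE_def closed tot_op_inv eta_inv elim!: total_quandle_cases)
  show "add total_object (add total_object (u, v), w) = add total_object (u, add total_object (v, w))"
    if "u \<in> carrier (tot (base total_object))" "v \<in> carrier (tot (base total_object))"
      "w \<in> carrier (tot (base total_object))"
      "proj (base total_object) u = proj (base total_object) v"
      "proj (base total_object) v = proj (base total_object) w" for u v w
    using that comm_monoid.axioms(1)[OF comm(1)]
    by (auto simp: closed monoid.m_assoc elim!: total_quandle_cases)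
  show "add total_object (u, v) = add total_object (v, u)"
    if "u \<in> carrier (tot (base total_object))" "v \<in> carrier (tot (base total_object))"
      "proj (base total_object) u = proj (base total_object) v" for u v
    using that comm_monoid.m_comm[OF comm(1)] by (auto elim!: total_quandle_cases)
  fix u assume u: "u \<in> carrier (tot (base total_object))"
  show "add total_object (zero total_object (proj (base total_object) u), u) = u"
    "add total_object (u, zero total_object (proj (base total_object) u)) = u"
    using u comm_monoid.axioms(1)[OF comm(1)] by (auto simp: closed elim!: total_quandle_cases)
  show "add total_object (neg total_object u, u) = zero total_object (proj (base total_object) u)"
    "add total_object (u, neg total_object u) = zero total_object (proj (base total_object) u)"
    using u comm(2) by (auto simp: closed group.l_inv group.r_inv elim!: total_quandle_cases)
qed

lemma fiber_total_eq:
  assumes "x \<in> carrier X"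
  shows "carrier (fiber_grp total_object x) = code x ` carrier (grp F x)"
  using assms by (auto elim!: total_quandle_cases)

text \<open>The group over \<open>x\<close> in the fibre module consists of codes, so it is a copy
  of \<open>grp F x\<close> and not the same group; \<open>val\<close> and \<open>code x\<close> are
  the mutually inverse comparison maps.\<close>

lemma fiber_module_total_iso:
  "\<exists>t. cat_iso (SQMod_cat X) (fiber_module total_object) F t"
proof -
  let ?M = "fiber_module total_object"
  let ?A = "\<lambda>x. carrier (fiber_grp total_object x)"
  let ?t = "\<lambda>x\<in>carrier X. \<lambda>u\<in>?A x. val u"
  let ?s = "\<lambda>x\<in>carrier X. \<lambda>a\<in>carrier (grp F x). code x a"
  note closed = qop_closed rho_closed phi_closed psi_closed eta_closed
  have mult_closed: "a \<otimes>\<^bsub>grp F x\<^esub> b \<in> carrier (grp F x)"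
    if "x \<in> carrier X" "a \<in> carrier (grp F x)" "b \<in> carrier (grp F x)" for x a b
    using grp_group[OF that(1)] that by (simp add: group_def monoid.m_closed)
  have A: "?A x = code x ` carrier (grp F x)" if "x \<in> carrier X" for x
    using fiber_total_eq[OF that] .
  have phi_code: "phi ?M x y (code x a) = code (x \<star> y) (phi F x y a)"
    if "x \<in> carrier X" "y \<in> carrier X" "a \<in> carrier (grp F x)" for x y a
    using that by (simp add: tot_op_one_right)
  have psi_code: "psi ?M x y (code y b) = code (x \<star> y) (psi F x y b)"
    if "x \<in> carrier X" "y \<in> carrier X" "b \<in> carrier (grp F y)" for x y b
    using that by (simp add: tot_op_one_left)
  have eta_code: "eta ?M x (code x a) = code (\<rho> x) (eta F x a)" if "x \<in> carrier X" for x a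
    using that by simp
  have mult_code: "code x a \<otimes>\<^bsub>fiber_grp total_object x\<^esub> code x b = code x (a \<otimes>\<^bsub>grp F x\<^esub> b)"
    if "x \<in> carrier X" "a \<in> carrier (grp F x)" "b \<in> carrier (grp F x)" for x a b
    using that by simp
  have t: "?t \<in> sqmod_hom X ?M F"
  proof (rule sqmod_homI)
    fix x assume x: "x \<in> carrier X"
    have "(\<lambda>u\<in>?A x. val u) \<in> hom (fiber_grp total_object x) (grp F x)"
      using x mult_closed unfolding hom_def by (auto simp: A[OF x] mult_code simp del: fiber_grp_simps)
    then show "?t x \<in> hom (grp ?M x) (grp F x)" "?t x \<in> extensional (carrier (grp ?M x))"
      using x by simp_all
  \<comment> \<open>The projections of \<open>?M\<close> are kept folded so that
    \<open>phi_code\<close>, \<open>psi_code\<close> and \<open>eta_code\<close> can rewrite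
    them.\<close>
  qed (auto simp: A phi_code psi_code eta_code closed simp del: fiber_grp_simps fiber_module_simps(2-))
  have s: "?s \<in> sqmod_hom X F ?M"
  proof (rule sqmod_homI)
    fix x assume x: "x \<in> carrier X"
    have "(\<lambda>a\<in>carrier (grp F x). code x a) \<in> hom (grp F x) (fiber_grp total_object x)"
      using x mult_closed unfolding hom_def by (auto simp: A[OF x] mult_code simp del: fiber_grp_simps)
    then show "?s x \<in> hom (grp F x) (grp ?M x)" "?s x \<in> extensional (carrier (grp F x))"
      using x by simp_all
  qed (auto simp: A phi_code psi_code eta_code closed simp del: fiber_grp_simps fiber_module_simps(2-))
  have "(\<lambda>x\<in>carrier X. compose (?A x) (?s x) (?t x)) = (\<lambda>x\<in>carrier X. \<lambda>u\<in>?A x. u)"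
    "(\<lambda>x\<in>carrier X. compose (carrier (grp F x)) (?t x) (?s x)) =
      (\<lambda>x\<in>carrier X. \<lambda>a\<in>carrier (grp F x). a)"
    by (auto simp: A compose_def fun_eq_iff simp del: fiber_grp_simps)
  then have "cat_iso (SQMod_cat X) ?M F ?t"
    unfolding cat_iso_def SQMod_cat_simps fiber_module_simps(1) using t s by blast
  then show ?thesis by blast
qed

end

section \<open>Existence of the encoding and the equivalence\<close>

text \<open>Cardinal arithmetic: an infinite set is equipotent with its square.\<close>

lemma infinite_pairing:
  assumes "infinite (UNIV :: 'u set)"
  obtains e :: "'u \<times> 'u \<Rightarrow> 'u" where "bij e"
  using card_of_Times_same_infinite[OF assms]
    card_of_ordIso[of "UNIV :: ('u \<times> 'u) set" "UNIV :: 'u set"]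
  by auto

text \<open>The index is moved into \<open>'u\<close> by \<open>j\<close> and then paired with the
  group element; decoding inverts \<open>j\<close> only over \<open>carrier X\<close>, where it is
  injective.\<close>

lemma sq_module_encoding:
  fixes j :: "'x \<Rightarrow> 'u" and F :: "('x, 'u) sq_module"
  assumes "sq_module X F" and "infinite (UNIV :: 'u set)" and j: "inj_on j (carrier X)"
  obtains code ix val where "encoded_sq_module X F code ix val"
proof -
  obtain e :: "'u \<times> 'u \<Rightarrow> 'u" where "bij e"
    using infinite_pairing[OF assms(2)] .
  then have inv_e: "inv_into UNIV e (e z) = z" for z
    by (simp add: bij_is_inj)
  have "encoded_sq_module X F (\<lambda>x a. e (j x, a))
      (\<lambda>u. inv_into (carrier X) j (fst (inv_into UNIV e u))) (\<lambda>u. snd (inv_into UNIV e u))"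
    using assms(1) j by (simp add: encoded_sq_module_def encoded_sq_module_axioms_def inv_e)
  then show thesis by (rule that)
qed

theorem theorem4p5:
  fixes X :: "'x sym_quandle"
  assumes "sym_quandle X"
    and "infinite (UNIV :: 'u set)"
    and "\<exists>j :: 'x \<Rightarrow> 'u. inj_on j (carrier X)"
  shows "equivalent_categories
    (Ab_cat X :: (('x, 'u) ab_object, 'u \<Rightarrow> 'u) category)
    (SQMod_cat X :: (('x, 'u) sq_module, 'x \<Rightarrow> 'u \<Rightarrow> 'u) category)"
proof (rule equivalent_categoriesI[OF category_Ab_cat category_SQMod_cat[OF assms(1)]
      cat_functor_fiber_functor[OF assms(1)]])
  fix M N :: "('x, 'u) ab_object"
  assume "M \<in> Obj (Ab_cat X)" "N \<in> Obj (Ab_cat X)"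
  then show "bij_betw (fmor (fiber_functor X) M N) (Hom (Ab_cat X) M N)
      (Hom (SQMod_cat X) (fobj (fiber_functor X) M) (fobj (fiber_functor X) N))"
    using fully_faithful_fiber_functor[OF assms(1)] by (simp del: fiber_functor_simps(2))
next
  fix F :: "('x, 'u) sq_module" assume "F \<in> Obj (SQMod_cat X)"
  then have F: "sq_module X F" by simp
  \<comment> \<open>Essential surjectivity treats one module at a time, so the encodings of
    different modules need not be related.\<close>
  obtain j :: "'x \<Rightarrow> 'u" where "inj_on j (carrier X)"
    using assms(3) by blast
  then obtain code ix val where "encoded_sq_module X F code ix val"
    using sq_module_encoding[OF F assms(2)] by blast
  then interpret encoded_sq_module X F code ix val .
  show "\<exists>M\<in>Obj (Ab_cat X). \<exists>t. cat_iso (SQMod_cat X) (fobj (fiber_functor X) M) F t"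
    using abelian_group_object_total fiber_module_total_iso by auto
qed

end
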